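(* Let $\mathscr B$ and $X_\eta$ be as in the context. For every ergodic $S$-invariant Borel probability measure $\nu$ on $X_\eta$ there exist a set $\mathscr B'=\{b'_1,b'_2,\dots\}\subset\{2,3,\dots\}$ with pairwise coprime elements and $\sum_k 1/b'_k<\infty$, such that the corresponding $\mathscr B'$-free subshift satisfies $X_{\eta'}\subset X_\eta$, and an ergodic $S\times S$-invariant probability measure $\widetilde\rho$ on $X_\eta\times\{0,1\}^{\mathbb Z}$ whose projection to the first coordinate is the Mirsky measure $\nu_{\mathscr B'}$ and such that $M_*(\widetilde\rho)=\nu$.
   Context: Let $S$ be the shift on $\{0,1\}^{\mathbb Z}$, $(Sx)(n)=x(n+1)$. For a set $\mathscr{B}=\{b_1,b_2,\dots\}\subset\{2,3,\dots\}$ with $\gcd(b_i,b_j)=1$ for $i\ne j$ and $\sum_i1/b_i<\infty$, define $\eta\in\{0,1\}^{\mathbb Z}$ by $\eta(n)=1$ iff $b_i\nmid n$ for all $i$, and let $X_\eta$ (the $\mathscr B$-free subshift) be the set of $y\in\{0,1\}^{\mathbb Z}$ all of whose finite blocks occur in $\eta$; equivalently $y\in X_\eta$ iff $|\mathrm{supp}(y)\bmod b_i|<b_i$ for all $i$, where $\mathrm{supp}(y)=\{n:y(n)=1\}$. Let $\Omega=\prod_i\mathbb Z/b_i\mathbb Z$ with normalized Haar measure $\mathbb P$, and $\varphi:\Omega\to\{0,1\}^{\mathbb Z}$, $\varphi(\omega)(n)=1$ iff $\omega(i)+n\not\equiv0\pmod{b_i}$ for all $i$. The Mirsky measure of $\mathscr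 B$ is $\nu_{\mathscr B}=\varphi_*\mathbb P$, an $S$-invariant measure on $X_\eta$; $\eta'$, $X_{\eta'}$, $\nu_{\mathscr B'}$ denote the analogous objects for $\mathscr B'$. The map $M:X_\eta\times\{0,1\}^{\mathbb Z}\to X_\eta$ is $M(x,u)(n)=x(n)u(n)$. *)

theory Defs
  imports "HOL-Probability.Probability"
begin

text \<open>The full shift space \<open>{0,1}^Z\<close> with its product (cylinder) sigma algebra,
  which coincides with the Borel sigma algebra of the product topology.\<close>
definition SS :: "(int \<Rightarrow> bool) measure" where
  "SS = PiM (UNIV :: int set) (\<lambda>_. count_space (UNIV :: bool set))"

definition shift :: "(int \<Rightarrow> bool) \<Rightarrow> (int \<Rightarrow> bool)" where
  "shift x = (\<lambda>n. x (n + 1))"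

definition admissible_B :: "nat set \<Rightarrow> bool" where
  "admissible_B B \<longleftrightarrow> B \<subseteq> {2..} \<and> pairwise coprime B \<and>
     (\<lambda>b. 1 / real b) summable_on B"

definition eta :: "nat set \<Rightarrow> int \<Rightarrow> bool" where
  "eta B n \<longleftrightarrow> (\<forall>b\<in>B. \<not> int b dvd n)"

definition Xeta :: "nat set \<Rightarrow> (int \<Rightarrow> bool) set" where
  "Xeta B = {y. \<forall>(m::int) (L::nat). \<exists>k::int. \<forall>j<L. y (m + int j) = eta B (k + int j)}"

text \<open>\<open>Omega = prod_{b in B} Z/bZ\<close> with Haar (product of uniform) measure.\<close>
definition Omega :: "nat set \<Rightarrow> (nat \<Rightarrow> nat) measure" where
  "Omega B = PiM B (\<lambda>b. uniform_count_measure {0..<b})"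

definition phi :: "nat set \<Rightarrow> (nat \<Rightarrow> nat) \<Rightarrow> (int \<Rightarrow> bool)" where
  "phi B \<omega> = (\<lambda>n. \<forall>b\<in>B. (int (\<omega> b) + n) mod int b \<noteq> 0)"

definition mirsky :: "nat set \<Rightarrow> (int \<Rightarrow> bool) measure" where
  "mirsky B = distr (Omega B) SS (phi B)"

definition invariant_measure :: "'a measure \<Rightarrow> ('a \<Rightarrow> 'a) \<Rightarrow> bool" where
  "invariant_measure M T \<longleftrightarrow> T \<in> M \<rightarrow>\<^sub>M M \<and> distr M M T = M"

definition ergodic :: "'a measure \<Rightarrow> ('a \<Rightarrow> 'a) \<Rightarrow> bool" where
  "ergodic M T \<longleftrightarrow> invariant_measure M T \<and>
     (\<forall>A\<in>sets M. T -` A \<inter> space M = A \<longrightarrow> emeasure M A = 0 \<or> emeasure M A = 1)"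

end

theory Submission
  imports Defs "HOL-Number_Theory.Cong"
begin

text \<open>For \<open>b\<close> in \<open>B\<close>, the set of integers whose residue mod \<open>b\<close> is missed by the support of a
  point \<open>x\<close> is \<open>b\<close>-periodic and depends equivariantly on \<open>x\<close>, so by ergodicity it is almost surely
  a translate of a fixed set \<open>A b\<close>. Let \<open>d b\<close>, a divisor of \<open>b\<close>, be the least period of \<open>A b\<close>, and
  \<open>B' = {d b | b \<in> B}\<close>. The translation amounts, taken mod \<open>d b\<close>, form an equivariant map \<open>\<theta>\<close> from
  \<open>\<nu>\<close>-almost all points to \<open>Omega B'\<close> with \<open>x \<le> phi B' (\<theta> x)\<close> pointwise. The odometer on \<open>Omega B'\<close>
  is uniquely ergodic, so \<open>\<theta>\<close> maps \<open>\<nu>\<close> to the Haar measure, and the joining is simply the image of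
  \<open>\<nu>\<close> under \<open>x \<mapsto> (phi B' (\<theta> x), x)\<close>, ergodic as a factor of \<open>\<nu>\<close>. Since
  \<open>\<nu> {x. x 0} \<le> \<Prod> (1 - 1 / d b)\<close>, the sum of \<open>1 / d b\<close> is finite unless \<open>\<nu> {x. x 0} = 0\<close>; in
  that case \<open>\<nu>\<close> is the Dirac measure at \<open>0\<close> and \<open>B' = B\<close> works.\<close>

section \<open>A sieve for admissible sets\<close>

text \<open>The Chinese remainder theorem with integer targets but a natural solution: the solution
  later serves as the positive starting point of a progression and as the number of iterations of
  the odometer.\<close>

lemma crt_int:
  fixes r :: "nat \<Rightarrow> int"
  assumes "finite F" "F \<subseteq> {1..}" "pairwise coprime F"
  obtains k :: nat where "\<And>b. b \<in> F \<Longrightarrow> int b dvd int k - r b"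
proof -
  have "\<exists>x. \<forall>b\<in>F. [x = nat (r b mod int b)] (mod b)"
    using assms by (intro chinese_remainder_nat) (auto simp: pairwise_def)
  then obtain k where k: "\<And>b. b \<in> F \<Longrightarrow> [k = nat (r b mod int b)] (mod b)"
    by blast
  have "int b dvd int k - r b" if "b \<in> F" for b
  proof -
    have "b > 0" using assms(2) that by auto
    then have "[int k = r b mod int b] (mod int b)"
      using k[OF that] by (simp flip: cong_int_iff)
    then have "[int k = r b] (mod int b)" by simp
    then show ?thesis by (simp only: cong_iff_dvd_diff)
  qed
  then show thesis using that by blast
qed

lemma summable_on_small_tail:
  fixes f :: "'a \<Rightarrow> real"
  assumes "f summable_on A" "\<epsilon> > 0"
  obtains F where "finite F" "F \<subseteq> A"
    "\<And>G. finite G \<Longrightarrow> G \<subseteq> A - F \<Longrightarrow> sum f G < \<epsilon>"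
proof -
  obtain s where "(f has_sum s) A" using assms(1) by (auto simp: summable_on_def)
  then have "\<forall>\<^sub>F F in finite_subsets_at_top A. dist (sum f F) s < \<epsilon> / 2"
    unfolding has_sum_def using assms(2) by (intro tendstoD) auto
  then obtain F where F: "finite F" "F \<subseteq> A"
    and *: "\<forall>G. finite G \<and> F \<subseteq> G \<and> G \<subseteq> A \<longrightarrow> dist (sum f G) s < \<epsilon> / 2"
    unfolding eventually_finite_subsets_at_top by (elim exE conjE) (rule that)
  have "sum f G < \<epsilon>" if G: "finite G" "G \<subseteq> A - F" for G
  proof -
    have "sum f (F \<union> G) = sum f F + sum f G"
      using F G by (intro sum.union_disjoint) auto
    moreover have "dist (sum f (F \<union> G)) s < \<epsilon> / 2" "dist (sum f F) s < \<epsilon> / 2"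
      using F G * by auto
    ultimately show ?thesis by (simp add: dist_real_def abs_if split: if_splits)
  qed
  then show thesis by (rule that[OF F])
qed

text \<open>Since \<open>N\<close> is invertible mod \<open>b\<close>, the solutions
  \<open>t\<close> all lie in one residue class mod \<open>b\<close>, so at most one of them falls
  in each interval of length \<open>b\<close>; hence \<open>t div b\<close> is injective on
  them.\<close>

lemma card_dvd_progression_le:
  fixes c :: int and b N T :: nat
  assumes "coprime b N" "b > 0"
  shows "real (card {t\<in>{1..T}. int b dvd c + int N * int t}) \<le> T / b + 1"
proof -
  let ?S = "{t\<in>{1..T}. int b dvd c + int N * int t}"
  have "inj_on (\<lambda>t. t div b) ?S"
  proof (rule inj_onI)
    fix s t assume s: "s \<in> ?S" and t: "t \<in> ?S" and eq: "s div b = t div b"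
    have "int b dvd (c + int N * int s) - (c + int N * int t)"
      using s t by (intro dvd_diff) auto
    then have "int b dvd int N * (int s - int t)" by (simp add: algebra_simps)
    then have "int b dvd int s - int t"
      using assms(1) by (simp add: coprime_dvd_mult_right_iff)
    then have "[s = t] (mod b)"
      by (simp add: cong_iff_dvd_diff flip: cong_int_iff)
    then have "s div b * b + s mod b = t div b * b + t mod b"
      by (simp add: cong_def eq)
    then show "s = t" by simp
  qed
  moreover have "(\<lambda>t. t div b) ` ?S \<subseteq> {..T div b}" by (auto intro: div_le_mono)
  ultimately have "card ?S \<le> card {..T div b}" by (intro card_inj_on_le) auto
  then have "real (card ?S) \<le> real (T div b) + 1" by simp
  also have "real (T div b) \<le> T / b" by (metis of_nat_div_le_of_nat)
  finally show ?thesis by simp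
qed

text \<open>The elements of \<open>B - F\<close> up to \<open>X\<close> kill at most \<open>L (T / b + 1)\<close> each of the \<open>T\<close> candidates
  \<open>k0 + N t\<close>; the error terms \<open>1\<close> are harmless because summability of \<open>1 / b\<close> makes the number
  of elements of \<open>B\<close> up to \<open>X\<close> sublinear in \<open>X\<close>.\<close>
lemma sieve:
  assumes adm: "admissible_B B" and F0: "finite F0" "F0 \<subseteq> B"
  obtains F where "finite F" "F0 \<subseteq> F" "F \<subseteq> B"
    "\<And>r :: nat \<Rightarrow> int. \<exists>k::int. (\<forall>b\<in>F. int b dvd k - r b) \<and>
       (\<forall>b\<in>B - F. \<forall>j<L. \<not> int b dvd k + int j)"
proof -
  have B2: "B \<subseteq> {2..}" and cop: "pairwise coprime B"
    and sm: "(\<lambda>b. 1 / real b) summable_on B"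
    using adm by (auto simp: admissible_B_def)
  \<comment> \<open>With this tail bound the main terms \<open>T / b\<close>, summed over the moduli
    outside \<open>F1\<close> and over \<open>L\<close> positions, stay below
    \<open>T / 4\<close>.\<close>
  obtain F1 where F1: "finite F1" "F1 \<subseteq> B"
    "\<And>G. finite G \<Longrightarrow> G \<subseteq> B - F1 \<Longrightarrow> (\<Sum>b\<in>G. 1 / real b) < 1 / (4 * (real L + 1))"
    by (rule summable_on_small_tail[OF sm, of "1 / (4 * (real L + 1))"]) auto
  define F where "F = F0 \<union> F1"
  have F: "finite F" "F \<subseteq> B" using F0 F1 by (auto simp: F_def)
  define N where "N = \<Prod>F"
  have N0: "N > 0" using F B2 by (auto simp: N_def prod_pos)
  have copN: "coprime b N" if "b \<in> B - F" for b
    unfolding N_def using cop that F by (intro prod_coprime_right) (fastforce simp: pairwise_def)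
  have dvdN: "b dvd N" if "b \<in> F" for b
    unfolding N_def using that F by (intro dvd_prodI[where f = "\<lambda>x. x", simplified]) auto
  have ex: "\<exists>k::int. (\<forall>b\<in>F. int b dvd k - r b) \<and> (\<forall>b\<in>B - F. \<forall>j<L. \<not> int b dvd k + int j)"
    for r :: "nat \<Rightarrow> int"
  proof -
    have "F \<subseteq> {1..}" using F B2 by force
    moreover have "pairwise coprime F" using cop F(2) by (rule pairwise_subset)
    ultimately obtain k0 :: nat where k0: "\<And>b. b \<in> F \<Longrightarrow> int b dvd int k0 - r b"
      using crt_int[of F r] F(1) by blast
    \<comment> \<open>For \<open>1 \<le> t \<le> T\<close> and \<open>j < L\<close>, the number
      \<open>k0 + N * t + j\<close> is at most \<open>C * T\<close>, so only the moduli collected in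
      \<open>H\<close> below can divide it.\<close>
    define C where "C = k0 + N + L"
    have C0: "C > 0" using N0 by (simp add: C_def)
    \<comment> \<open>\<open>F\<close> had to be fixed before \<open>r\<close>, hence before
      \<open>k0\<close> and \<open>C\<close>. The second cut \<open>F2\<close> may depend on them;
      \<open>\<epsilon>\<close> is chosen so that \<open>C * T * \<epsilon>\<close>, which bounds
      the number of elements of \<open>H\<close> outside \<open>F2\<close>, is
      \<open>T / (4 * (L + 1))\<close>.\<close>
    define \<epsilon> where "\<epsilon> = 1 / (4 * (real L + 1) * C)"
    have "\<epsilon> > 0" using C0 by (simp add: \<epsilon>_def)
    then obtain F2 where F2: "finite F2" "F2 \<subseteq> B"
      "\<And>G. finite G \<Longrightarrow> G \<subseteq> B - F2 \<Longrightarrow> (\<Sum>b\<in>G. 1 / real b) < \<epsilon>"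
      using summable_on_small_tail[OF sm] by blast
    \<comment> \<open>This makes the contribution \<open>L * card F2\<close> of the remaining error
      terms strictly smaller than \<open>T / 2\<close>; the other terms take at most the other
      half.\<close>
    define T where "T = 4 * L * card F2 + 1"
    define H where "H = {b \<in> B - F. b \<le> C * T}"
    have finH: "finite H" by (rule finite_subset[of _ "{..C*T}"]) (auto simp: H_def)
    define bad where "bad b j = {t\<in>{1..T}. int b dvd (int k0 + int j) + int N * int t}" for b j
    have cardbad: "real (card (bad b j)) \<le> T / b + 1" if "b \<in> H" for b j
      unfolding bad_def using that B2
      by (intro card_dvd_progression_le copN) (auto simp: H_def)
    have sumH: "(\<Sum>b\<in>H. 1 / real b) \<le> 1 / (4 * (real L + 1))"
      by (rule less_imp_le[OF F1(3)[OF finH]]) (auto simp: H_def F_def)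
    \<comment> \<open>Each \<open>b \<in> H\<close> satisfies \<open>b \<le> C * T\<close>, so the
      constant 1 is at most \<open>C * T / b\<close>, and counting reduces to the small tail
      sum.\<close>
    have "real (card (H - F2)) = (\<Sum>b\<in>H-F2. 1)" by simp
    also have "\<dots> \<le> (\<Sum>b\<in>H-F2. real C * real T * (1 / real b))"
    proof (rule sum_mono)
      fix b assume b: "b \<in> H - F2"
      then have "b > 0" "b \<le> C * T" using B2 by (auto simp: H_def)
      then have "real b \<le> real C * real T" by (simp flip: of_nat_mult)
      then show "1 \<le> real C * real T * (1 / real b)" using \<open>b > 0\<close> by (simp add: field_simps)
    qed
    also have "\<dots> = real C * real T * (\<Sum>b\<in>H-F2. 1 / real b)" by (simp add: sum_distrib_left)
    also have "\<dots> \<le> real C * real T * \<epsilon>"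
    proof (rule mult_left_mono)
      show "(\<Sum>b\<in>H-F2. 1 / real b) \<le> \<epsilon>"
        by (rule less_imp_le[OF F2(3)]) (use finH in \<open>auto simp: H_def\<close>)
    qed simp
    also have "\<dots> = T / (4 * (real L + 1))" using C0 by (simp add: \<epsilon>_def)
    finally have cardHF: "real (card (H - F2)) \<le> T / (4 * (real L + 1))" .
    have "card H \<le> card (F2 \<union> (H - F2))" using F2 finH by (intro card_mono) auto
    also have "\<dots> \<le> card F2 + card (H - F2)" by (rule card_Un_le)
    finally have "real (card H) \<le> real (card F2) + real (card (H - F2))" by linarith
    with cardHF have cardH: "real (card H) \<le> real (card F2) + T / (4 * (real L + 1))" by linarith
    have L1: "real L * (T / (4 * (real L + 1))) \<le> T / 4"
      by (simp add: field_simps)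
    have "real (card (\<Union>b\<in>H. \<Union>j<L. bad b j)) \<le> real (\<Sum>b\<in>H. \<Sum>j<L. card (bad b j))"
      using finH by (intro of_nat_mono order_trans[OF card_UN_le] sum_mono) auto
    also have "\<dots> = (\<Sum>b\<in>H. \<Sum>j<L. real (card (bad b j)))" by simp
    also have "\<dots> \<le> (\<Sum>b\<in>H. \<Sum>j<L. T / b + 1)"
      by (intro sum_mono cardbad)
    also have "\<dots> = real L * real T * (\<Sum>b\<in>H. 1 / real b) + real L * real (card H)"
      by (simp add: sum.distrib sum_distrib_left algebra_simps)
    also have "\<dots> \<le> real L * real T * (1 / (4 * (real L + 1))) + real L * (real (card F2) + T / (4 * (real L + 1)))"
      using sumH cardH by (intro add_mono mult_left_mono) auto
    also have "\<dots> = 2 * (real L * (T / (4 * (real L + 1)))) + real L * real (card F2)"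
      by (simp add: algebra_simps)
    also have "\<dots> \<le> T / 2 + real L * real (card F2)" using L1 by linarith
    also have "\<dots> < T"
      unfolding T_def by (simp add: add_nonneg_pos)
    finally have "card (\<Union>b\<in>H. \<Union>j<L. bad b j) < card {1..T}" by simp
    then have "\<not> {1..T} \<subseteq> (\<Union>b\<in>H. \<Union>j<L. bad b j)"
      using card_mono[of "\<Union>b\<in>H. \<Union>j<L. bad b j" "{1..T}"] finH
      by (fastforce simp: bad_def)
    then obtain t where t: "t \<in> {1..T}" "\<And>b j. b \<in> H \<Longrightarrow> j < L \<Longrightarrow> t \<notin> bad b j"
      by blast
    define k where "k = k0 + N * t"
    show ?thesis
    proof (intro exI[of _ "int k"] conjI ballI allI impI)
      fix b assume "b \<in> F"
      have "int k - r b = (int k0 - r b) + int N * int t" by (simp add: k_def)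
      moreover have "int b dvd int N" using dvdN[OF \<open>b \<in> F\<close>] by simp
      ultimately show "int b dvd int k - r b"
        using k0[OF \<open>b \<in> F\<close>] by (metis dvd_add dvd_mult2)
    next
      fix b j assume b: "b \<in> B - F" and j: "j < L"
      show "\<not> int b dvd int k + int j"
      proof
        assume d: "int b dvd int k + int j"
        then have "int b dvd int (k + j)" by simp
        then have "b dvd k + j" by (simp only: int_dvd_int_iff)
        \<comment> \<open>Positivity turns divisibility into the size bound
          \<open>b \<le> k + j\<close>; it comes from \<open>t \<ge> 1\<close>.\<close>
        moreover have "k + j > 0" using N0 t by (auto simp: k_def)
        ultimately have "b \<le> k + j" by (intro dvd_imp_le)
        also have "\<dots> \<le> k0 * T + N * T + L * T"
        proof -
          have "1 \<le> T" using t by simp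
          then have "k0 * 1 \<le> k0 * T" "L * 1 \<le> L * T" by (intro mult_le_mono; simp)+
          moreover have "N * t \<le> N * T" using t by simp
          ultimately show ?thesis using j unfolding k_def by linarith
        qed
        finally have "b \<in> H" using b by (simp add: H_def C_def algebra_simps)
        moreover have "t \<in> bad b j" using d t by (simp add: bad_def k_def algebra_simps)
        ultimately show False using t j by blast
      qed
    qed
  qed
  show thesis by (rule that[OF F(1) _ F(2) ex]) (simp add: F_def)
qed

text \<open>The block is copied by prescribing the residues of its position in \<open>eta B\<close>
  modulo finitely many \<open>b\<close>; the sieve keeps all other moduli away from the block. If
  \<open>d\<close> is the identity, the modulus that produces a zero of \<open>phi\<close> can be
  reused. If \<open>d b\<close> is a proper divisor, one class mod \<open>d b\<close> splits into
  several classes mod \<open>b\<close>, of which \<open>b\<close> removes only one, so the zeros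
  need further moduli and \<open>B\<close> has to be infinite. For \<open>B = {4}\<close> and
  \<open>d 4 = 2\<close>, the block 0 1 0 does occur in \<open>phi\<close> but not in
  \<open>eta\<close>.\<close>

lemma phi_block_in_eta:
  fixes \<omega> :: "nat \<Rightarrow> nat"
  assumes adm: "admissible_B B" and d: "\<And>b. b \<in> B \<Longrightarrow> d b dvd b"
    and inf: "infinite B \<or> (\<forall>b\<in>B. d b = b)"
  obtains k where "\<And>j. j < L \<Longrightarrow> phi (d ` B) \<omega> (m + int j) \<longleftrightarrow> eta B (k + int j)"
proof -
  have phi: "phi (d ` B) \<omega> n \<longleftrightarrow> (\<forall>b\<in>B. \<not> int (d b) dvd int (\<omega> (d b)) + n)" for n
    by (auto simp: phi_def dvd_eq_mod_eq_0)
  define Z where "Z = {j\<in>{..<L}. \<not> phi (d ` B) \<omega> (m + int j)}"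
  have finZ: "finite Z" by (simp add: Z_def)
  \<comment> \<open>With \<open>k\<close> congruent to \<open>r b\<close> mod \<open>b\<close>, the
    modulus \<open>c j\<close> produces the zero at \<open>j \<in> Z\<close>, and the last conjunct
    says that no modulus destroys a one of the block.\<close>
  have "\<exists>c r. c ` Z \<subseteq> B \<and> (\<forall>j\<in>Z. int (c j) dvd r (c j) + int j) \<and>
          (\<forall>b\<in>B. \<forall>j\<in>{..<L} - Z. \<not> int b dvd r b + int j)"
  proof (cases "\<forall>b\<in>B. d b = b")
    case True
    have "\<forall>j\<in>Z. \<exists>b\<in>B. int b dvd int (\<omega> b) + (m + int j)"
      using True phi by (fastforce simp: Z_def)
    then obtain c where "\<forall>j\<in>Z. c j \<in> B \<and> int (c j) dvd int (\<omega> (c j)) + (m + int j)"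
      by metis
    moreover have "\<forall>b\<in>B. \<forall>j\<in>{..<L} - Z. \<not> int b dvd int (\<omega> b) + (m + int j)"
      using True phi unfolding Z_def by fastforce
    ultimately show ?thesis
      by (intro exI[of _ c] exI[of _ "\<lambda>b. int (\<omega> b) + m"]) (auto simp: algebra_simps)
  next
    case False
    then have "infinite B" using inf by blast
    then have "infinite (B - {..L})" by (simp add: Diff_infinite_finite)
    then obtain c :: "nat \<Rightarrow> nat" where c: "inj c" "range c \<subseteq> B - {..L}"
      using infinite_countable_subset by blast
    \<comment> \<open>each position to be cleared gets its own modulus, larger than the block length, so that it
      clears no other position of the block\<close>
    define r where "r b = (if b \<in> c ` Z then - int (the_inv_into Z c b) else int (\<omega> (d b)) + m)" for b
    have injZ: "inj_on c Z" using c(1) by (rule inj_on_subset) simp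
    have rc: "r (c j) = - int j" if "j \<in> Z" for j
      using that by (simp add: r_def the_inv_into_f_f[OF injZ])
    have "\<not> int b dvd r b + int j" if "b \<in> B" "j \<in> {..<L} - Z" for b j
    proof (cases "b \<in> c ` Z")
      case True
      then obtain i where i: "i \<in> Z" "b = c i" by blast
      have "b > L" using c(2) i(2) by (metis DiffE atMost_iff not_le rangeI subsetD)
      show ?thesis
      proof
        assume "int b dvd r b + int j"
        then have *: "int b dvd int j - int i" using rc[OF i(1)] i by simp
        have "j \<noteq> i" using i that by auto
        then have "int b \<le> \<bar>int j - int i\<bar>" using dvd_imp_le_int[OF _ *] by simp
        then show False using \<open>b > L\<close> i that by (auto simp: Z_def)
      qed
    next
      case False
      show ?thesis
      proof
        assume "int b dvd r b + int j"
        then have "int (d b) dvd r b + int j"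
          using d that(1) by (meson dvd_trans int_dvd_int_iff)
        then have "int (d b) dvd int (\<omega> (d b)) + (m + int j)"
          using False by (simp add: r_def algebra_simps)
        moreover have "phi (d ` B) \<omega> (m + int j)" using that by (auto simp: Z_def)
        ultimately show False using \<open>b \<in> B\<close> unfolding phi by blast
      qed
    qed
    moreover have "c ` Z \<subseteq> B" using c(2) by blast
    ultimately show ?thesis
      using rc by (intro exI[of _ c] exI[of _ r]) auto
  qed
  then obtain c r where c: "c ` Z \<subseteq> B" "\<forall>j\<in>Z. int (c j) dvd r (c j) + int j"
    and r: "\<forall>b\<in>B. \<forall>j\<in>{..<L} - Z. \<not> int b dvd r b + int j"
    by (elim exE conjE) (rule that)
  \<comment> \<open>The moduli \<open>c j\<close> must belong to \<open>F\<close>, because only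
    there is the residue of \<open>k\<close> under control; elsewhere the sieve just prevents
    divisibility.\<close>
  obtain F where F: "finite F" "c ` Z \<subseteq> F" "F \<subseteq> B"
    and ex: "\<And>r :: nat \<Rightarrow> int. \<exists>k::int. (\<forall>b\<in>F. int b dvd k - r b) \<and>
       (\<forall>b\<in>B - F. \<forall>j<L. \<not> int b dvd k + int j)"
    by (rule sieve[OF adm finite_imageI[OF finZ] c(1), of L]) (rule that)
  obtain k where k1: "\<And>b. b \<in> F \<Longrightarrow> int b dvd k - r b"
    and k2: "\<And>b j. b \<in> B - F \<Longrightarrow> j < L \<Longrightarrow> \<not> int b dvd k + int j"
    using ex[of r] by (elim exE conjE) (rule that, auto)
  have k3: "int b dvd k + int j \<longleftrightarrow> int b dvd r b + int j" if "b \<in> F" for b j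
  proof -
    have "k + int j = (k - r b) + (r b + int j)" by simp
    then show ?thesis using k1[OF that] by (metis dvd_add_right_iff)
  qed
  have "phi (d ` B) \<omega> (m + int j) \<longleftrightarrow> eta B (k + int j)" if "j < L" for j
  proof (cases "j \<in> Z")
    case True
    then have "c j \<in> F" "c j \<in> B" using F by auto
    then have "\<not> eta B (k + int j)" using bspec[OF c(2) True] k3[of "c j" j] by (auto simp: eta_def)
    then show ?thesis using True by (simp add: Z_def)
  next
    case False
    then have "phi (d ` B) \<omega> (m + int j)" using that by (simp add: Z_def)
    moreover have "eta B (k + int j)"
      unfolding eta_def
    proof
      fix b assume "b \<in> B"
      then show "\<not> int b dvd k + int j"
        using k2[of b j] k3[of b j] bspec[OF bspec[OF r \<open>b \<in> B\<close>], of j] False that by blast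
    qed
    ultimately show ?thesis by simp
  qed
  then show thesis using that by blast
qed

lemma phi_in_Xeta:
  assumes "admissible_B B" "\<And>b. b \<in> B \<Longrightarrow> d b dvd b"
    and "infinite B \<or> (\<forall>b\<in>B. d b = b)"
  shows "phi (d ` B) \<omega> \<in> Xeta B"
proof -
  have "\<exists>k. \<forall>j<L. phi (d ` B) \<omega> (m + int j) = eta B (k + int j)" for m :: int and L :: nat
    by (rule phi_block_in_eta[OF assms, of L \<omega> m]) auto
  then show ?thesis by (simp add: Xeta_def)
qed

text \<open>The sequence \<open>eta\<close> of the divisors is itself a value of \<open>phi\<close>,
  at the point with all residues 0, so each of its blocks occurs in \<open>eta B\<close>, and with
  it each block of \<open>y\<close>.\<close>

lemma Xeta_mono:
  assumes "admissible_B B" "\<And>b. b \<in> B \<Longrightarrow> d b dvd b"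
    and "infinite B \<or> (\<forall>b\<in>B. d b = b)"
  shows "Xeta (d ` B) \<subseteq> Xeta B"
proof
  fix y assume y: "y \<in> Xeta (d ` B)"
  have eta: "eta (d ` B) = phi (d ` B) (\<lambda>_. 0)"
    by (auto simp: fun_eq_iff eta_def phi_def dvd_eq_mod_eq_0)
  have "\<exists>k. \<forall>j<L. y (m + int j) = eta B (k + int j)" for m :: int and L :: nat
  proof -
    obtain k where "\<forall>j<L. y (m + int j) = eta (d ` B) (k + int j)"
      using y unfolding Xeta_def by blast
    moreover obtain k' where "\<And>j. j < L \<Longrightarrow> eta (d ` B) (k + int j) = eta B (k' + int j)"
      unfolding eta by (rule phi_block_in_eta[OF assms, of L "\<lambda>_. 0" k]) auto
    ultimately show ?thesis by auto
  qed
  then show "y \<in> Xeta B" by (simp add: Xeta_def)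
qed

section \<open>The odometer on \<open>Omega B\<close>\<close>

text \<open>Ergodicity passes to factors. The map need only be equivariant on a set \<open>G\<close>
  of full measure; \<open>G\<close> itself is exactly invariant, so that intersecting a pulled back
  invariant set with \<open>G\<close> again gives an exactly invariant set, as the definition of
  \<open>ergodic\<close> demands.\<close>

lemma ergodic_distr:
  assumes erg: "ergodic M T"
    and \<pi>[measurable]: "\<pi> \<in> M \<rightarrow>\<^sub>M N" and T'[measurable]: "T' \<in> N \<rightarrow>\<^sub>M N"
    and G[measurable]: "G \<in> sets M" and AE_G: "AE x in M. x \<in> G"
    and inv: "\<And>x. x \<in> space M \<Longrightarrow> T x \<in> G \<longleftrightarrow> x \<in> G"
    and eqv: "\<And>x. x \<in> G \<Longrightarrow> \<pi> (T x) = T' (\<pi> x)"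
  shows "ergodic (distr M N \<pi>) T'"
proof -
  have T[measurable]: "T \<in> M \<rightarrow>\<^sub>M M" and TM: "distr M M T = M"
    and zo: "\<And>A. A \<in> sets M \<Longrightarrow> T -` A \<inter> space M = A \<Longrightarrow> emeasure M A = 0 \<or> emeasure M A = 1"
    using erg by (auto simp: ergodic_def invariant_measure_def)
  have "distr (distr M N \<pi>) (distr M N \<pi>) T' = distr (distr M N \<pi>) N T'"
    by (rule distr_cong) auto
  also have "\<dots> = distr M N (T' \<circ> \<pi>)" by (rule distr_distr) auto
  also have "\<dots> = distr M N (\<pi> \<circ> T)"
    by (rule distr_cong_AE) (use AE_G eqv in auto)
  also have "\<dots> = distr (distr M M T) N \<pi>" by (rule distr_distr[symmetric]) auto
  also have "\<dots> = distr M N \<pi>" by (simp add: TM)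
  finally have "distr (distr M N \<pi>) (distr M N \<pi>) T' = distr M N \<pi>" .
  moreover have "emeasure (distr M N \<pi>) A = 0 \<or> emeasure (distr M N \<pi>) A = 1"
    if A[measurable]: "A \<in> sets N" and TA: "T' -` A \<inter> space N = A" for A
  proof -
    define C where "C = \<pi> -` A \<inter> space M \<inter> G"
    have C[measurable]: "C \<in> sets M" unfolding C_def by measurable
    have "T -` C \<inter> space M = C"
    proof (intro set_eqI iffI)
      fix x assume "x \<in> T -` C \<inter> space M"
      then have x: "x \<in> space M" "x \<in> G" "\<pi> (T x) \<in> A"
        using inv by (auto simp: C_def)
      then have "\<pi> x \<in> T' -` A \<inter> space N"
        using eqv measurable_space[OF \<pi>] by auto
      then show "x \<in> C" using x TA by (simp add: C_def)
    next
      fix x assume "x \<in> C"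
      then have x: "x \<in> space M" "x \<in> G" "\<pi> x \<in> A" by (auto simp: C_def)
      then have "T' (\<pi> x) \<in> A" using TA by blast
      then show "x \<in> T -` C \<inter> space M"
        using x inv eqv measurable_space[OF T] by (auto simp: C_def)
    qed
    then have "emeasure M C = 0 \<or> emeasure M C = 1" by (intro zo C)
    moreover have "emeasure (distr M N \<pi>) A = emeasure M C"
      unfolding emeasure_distr[OF \<pi> A]
      by (rule emeasure_eq_AE) (use AE_G in \<open>auto simp: C_def\<close>)
    ultimately show ?thesis by simp
  qed
  ultimately show ?thesis by (simp add: ergodic_def invariant_measure_def)
qed

section \<open>The odometer and measurability of maps into its space\<close>

definition rotation :: "nat set \<Rightarrow> (nat \<Rightarrow> nat) \<Rightarrow> (nat \<Rightarrow> nat)" where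
  "rotation B \<omega> = (\<lambda>b\<in>B. (\<omega> b + 1) mod b)"

lemma space_Omega: "space (Omega B) = (\<Pi>\<^sub>E b\<in>B. {0..<b})"
  by (simp add: Omega_def space_PiM space_uniform_count_measure)

lemma sets_uniform_count_measure: "sets (uniform_count_measure A) = Pow A"
  by (simp add: uniform_count_measure_def sets_point_measure)

lemma measurable_component_Omega:
  assumes "b \<in> B"
  shows "(\<lambda>\<omega>. \<omega> b) \<in> Omega B \<rightarrow>\<^sub>M count_space UNIV"
proof -
  have "(\<lambda>\<omega>. \<omega> b) \<in> Omega B \<rightarrow>\<^sub>M uniform_count_measure {0..<b}"
    unfolding Omega_def using assms by (rule measurable_component_singleton)
  moreover have "(\<lambda>n. n) \<in> uniform_count_measure {0..<b} \<rightarrow>\<^sub>M count_space UNIV"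
    by (auto simp: measurable_def sets_uniform_count_measure space_uniform_count_measure)
  ultimately show ?thesis using measurable_compose by blast
qed

lemma measurable_into_Omega:
  assumes "\<And>b. b \<in> B \<Longrightarrow> (\<lambda>x. f x b) \<in> M \<rightarrow>\<^sub>M count_space UNIV"
    and "\<And>x. x \<in> space M \<Longrightarrow> f x \<in> space (Omega B)"
  shows "f \<in> M \<rightarrow>\<^sub>M Omega B"
  unfolding Omega_def
proof (rule measurable_PiM_single')
  fix b assume b: "b \<in> B"
  show "(\<lambda>x. f x b) \<in> M \<rightarrow>\<^sub>M uniform_count_measure {0..<b}"
  proof (rule measurableI)
    show "f x b \<in> space (uniform_count_measure {0..<b})" if "x \<in> space M" for x
      using assms(2)[OF that] b by (auto simp: space_Omega space_uniform_count_measure)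
    show "(\<lambda>x. f x b) -` A \<inter> space M \<in> sets M" if "A \<in> sets (uniform_count_measure {0..<b})" for A
      using measurable_sets[OF assms(1)[OF b], of A] by simp
  qed
qed (use assms(2) in \<open>auto simp: space_Omega space_uniform_count_measure\<close>)

lemma rotation_in_space:
  assumes "B \<subseteq> {1..}"
  shows "rotation B \<omega> \<in> space (Omega B)"
  using assms by (force simp: space_Omega rotation_def)

lemma measurable_rotation:
  assumes "B \<subseteq> {1..}"
  shows "rotation B \<in> Omega B \<rightarrow>\<^sub>M Omega B"
proof (rule measurable_into_Omega)
  fix b assume b: "b \<in> B"
  then have "(\<lambda>\<omega>. (\<omega> b + 1) mod b) \<in> Omega B \<rightarrow>\<^sub>M count_space UNIV"
    by (intro measurable_compose[OF measurable_component_Omega]) auto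
  then show "(\<lambda>\<omega>. rotation B \<omega> b) \<in> Omega B \<rightarrow>\<^sub>M count_space UNIV"
    using b by (simp add: rotation_def)
qed (rule rotation_in_space[OF assms])

lemma funpow_rotation:
  assumes "\<omega> \<in> space (Omega B)" "b \<in> B"
  shows "(rotation B ^^ t) \<omega> b = (\<omega> b + t) mod b"
proof (induction t)
  case 0
  then show ?case using PiE_mem[of \<omega> B "\<lambda>b. {0..<b}" b] assms by (simp add: space_Omega)
next
  case (Suc t)
  then show ?case using assms by (simp add: rotation_def mod_Suc_eq)
qed

lemma funpow_rotation_in_space:
  assumes "\<omega> \<in> space (Omega B)" "B \<subseteq> {1..}"
  shows "(rotation B ^^ t) \<omega> \<in> space (Omega B)"
  using assms rotation_in_space by (cases t) auto

section \<open>Cylinders, Haar measure and unique ergodicity\<close>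

definition cylinder :: "nat set \<Rightarrow> nat set \<Rightarrow> (nat \<Rightarrow> nat set) \<Rightarrow> (nat \<Rightarrow> nat) set" where
  "cylinder B J A = {\<omega> \<in> space (Omega B). \<forall>b\<in>J. \<omega> b \<in> A b}"

lemma cylinder_sets:
  assumes "finite J" "J \<subseteq> B"
  shows "cylinder B J A \<in> sets (Omega B)"
proof -
  have [measurable]: "(\<lambda>\<omega>. \<omega> b) \<in> Omega B \<rightarrow>\<^sub>M count_space UNIV" if "b \<in> J" for b
    using that assms by (intro measurable_component_Omega) auto
  show ?thesis unfolding cylinder_def using assms(1) by measurable
qed

lemma prod_emb_eq_cylinder:
  assumes "J \<subseteq> B"
  shows "prod_emb B (\<lambda>b. uniform_count_measure {0..<b}) J (Pi\<^sub>E J A) = cylinder B J A"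
  using assms unfolding prod_emb_def cylinder_def Omega_def by (auto simp: space_PiM Pi_iff)

lemma measure_Omega_cylinder:
  assumes "B \<subseteq> {1..}" "finite J" "J \<subseteq> B" "\<And>b. b \<in> J \<Longrightarrow> A b \<subseteq> {0..<b}"
  shows "measure (Omega B) (cylinder B J A) = (\<Prod>b\<in>J. card (A b) / b)"
proof -
  \<comment> \<open>The locale asks for a probability space at every natural index, including 0,
    where the uniform measure would live on the empty set. For \<open>b \<in> B\<close> the
    \<open>max\<close> changes nothing.\<close>
  let ?M = "\<lambda>b. uniform_count_measure {0..<max 1 b}"
  interpret product_prob_space ?M B
    by (intro product_prob_spaceI prob_space_uniform_count_measure) auto
  have M: "uniform_count_measure {0..<b} = ?M b" if "b \<in> B" for b
  proof -
    have "max 1 b = b" using that assms(1) by force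
    then show ?thesis by simp
  qed
  have Om: "Omega B = PiM B ?M"
    unfolding Omega_def using M by (intro PiM_cong) auto
  have "prod_emb B ?M J (Pi\<^sub>E J A) = cylinder B J A"
    using assms(3) unfolding prod_emb_def cylinder_def Om by (auto simp: space_PiM Pi_iff)
  then have "measure (Omega B) (cylinder B J A) = (\<Prod>b\<in>J. measure (?M b) (A b))"
    using measure_PiM_emb[of J A] assms by (simp add: Om sets_uniform_count_measure subset_eq)
  also have "\<dots> = (\<Prod>b\<in>J. card (A b) / b)"
  proof (rule prod.cong)
    fix b assume b: "b \<in> J"
    then have "max 1 b = b" using assms(1,3) by force
    then show "measure (?M b) (A b) = card (A b) / b"
      using measure_uniform_count_measure[of "{0..<b}" "A b"] assms(4)[OF b] by simp
  qed simp
  finally show ?thesis .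
qed

lemma prob_space_Omega: "B \<subseteq> {1..} \<Longrightarrow> prob_space (Omega B)"
  unfolding Omega_def by (intro prob_space_PiM prob_space_uniform_count_measure) force+

lemma eq_Omega_if_cylinders:
  assumes B: "B \<subseteq> {1..}" and \<mu>: "prob_space \<mu>" "sets \<mu> = sets (Omega B)"
    and eq: "\<And>J A. finite J \<Longrightarrow> J \<subseteq> B \<Longrightarrow> (\<And>b. b \<in> J \<Longrightarrow> A b \<subseteq> {0..<b}) \<Longrightarrow>
      measure \<mu> (cylinder B J A) = (\<Prod>b\<in>J. card (A b) / b)"
  shows "\<mu> = Omega B"
proof (rule measure_eqI_PiM_infinite[where I = B and M = "\<lambda>b. uniform_count_measure {0..<b}"])
  interpret \<mu>: prob_space \<mu> by fact
  interpret \<Omega>: prob_space "Omega B" using B by (rule prob_space_Omega)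
  show "finite_measure \<mu>" by unfold_locales
  show "sets \<mu> = sets (PiM B (\<lambda>b. uniform_count_measure {0..<b}))"
    "sets (Omega B) = sets (PiM B (\<lambda>b. uniform_count_measure {0..<b}))"
    using \<mu>(2) by (simp_all add: Omega_def)
  fix A J assume J: "finite J" "J \<subseteq> B" "\<And>i. i \<in> J \<Longrightarrow> A i \<in> sets (uniform_count_measure {0..<i})"
  then have A: "A b \<subseteq> {0..<b}" if "b \<in> J" for b
    using that by (auto simp: sets_uniform_count_measure)
  have "measure \<mu> (cylinder B J A) = measure (Omega B) (cylinder B J A)"
    using eq[of J A] measure_Omega_cylinder[OF B, of J A] J A by simp
  then show "emeasure \<mu> (prod_emb B (\<lambda>b. uniform_count_measure {0..<b}) J (Pi\<^sub>E J A)) =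
      emeasure (Omega B) (prod_emb B (\<lambda>b. uniform_count_measure {0..<b}) J (Pi\<^sub>E J A))"
    by (simp add: prod_emb_eq_cylinder[OF J(2)] \<mu>.emeasure_eq_measure \<Omega>.emeasure_eq_measure)
qed

text \<open>By the Chinese remainder theorem, a power of the odometer carries any one-point cylinder
  over a finite \<open>J\<close> onto any other. An invariant probability therefore gives all of
  them the same mass and agrees with Haar measure on cylinders.\<close>

lemma rotation_uniquely_ergodic:
  assumes B: "B \<subseteq> {1..}" and cop: "pairwise coprime B"
    and \<mu>: "prob_space \<mu>" "sets \<mu> = sets (Omega B)"
    and inv: "distr \<mu> \<mu> (rotation B) = \<mu>"
  shows "\<mu> = Omega B"
proof (rule eq_Omega_if_cylinders[OF B \<mu>])
  fix J A assume J: "finite J" "J \<subseteq> B" and A: "\<And>b. b \<in> J \<Longrightarrow> A b \<subseteq> {0..<b}"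
  interpret prob_space \<mu> by fact
  have sp: "space \<mu> = space (Omega B)" using \<mu>(2) by (rule sets_eq_imp_space_eq)
  have R[measurable]: "rotation B \<in> \<mu> \<rightarrow>\<^sub>M \<mu>"
    using measurable_rotation[OF B] by (simp add: measurable_cong_sets[OF \<mu>(2) \<mu>(2)])
  have Rt: "(rotation B ^^ t) \<in> \<mu> \<rightarrow>\<^sub>M \<mu>" for t
    by (induction t) (auto intro: measurable_comp[OF _ R])
  have invt: "distr \<mu> \<mu> (rotation B ^^ t) = \<mu>" for t
  proof (induction t)
    case 0
    then show ?case by (simp add: id_def)
  next
    case (Suc t)
    have "distr \<mu> \<mu> (rotation B ^^ Suc t) = distr (distr \<mu> \<mu> (rotation B ^^ t)) \<mu> (rotation B)"
      by (simp only: funpow.simps distr_distr[OF R Rt])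
    then show ?case by (simp only: Suc inv)
  qed
  define pt where "pt a = cylinder B J (\<lambda>b. {a b})" for a
  have ptm: "pt a \<in> sets \<mu>" for a
    using cylinder_sets[OF J] \<mu>(2) by (simp add: pt_def)
  have same: "prob (pt a) = prob (pt a')"
    if a: "a \<in> (\<Pi>\<^sub>E b\<in>J. {0..<b})" and a': "a' \<in> (\<Pi>\<^sub>E b\<in>J. {0..<b})" for a a'
  proof -
    have "J \<subseteq> {1..}" "pairwise coprime J"
      using J(2) B cop by (auto intro: pairwise_subset)
    \<comment> \<open>The number of steps has to move the residue \<open>a b\<close> to
      \<open>a' b\<close> for all \<open>b \<in> J\<close> simultaneously.\<close>
    then obtain t :: nat where t: "\<And>b. b \<in> J \<Longrightarrow> int b dvd int t - (int (a' b) - int (a b))"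
      using crt_int[OF J(1), of "\<lambda>b. int (a' b) - int (a b)"] by blast
    have "(rotation B ^^ t) -` pt a' \<inter> space \<mu> = pt a"
    proof -
      have "(\<omega> b + t) mod b = a' b \<longleftrightarrow> \<omega> b = a b"
        if "\<omega> \<in> space (Omega B)" "b \<in> J" for \<omega> b
      proof -
        have lt: "\<omega> b < b" "a b < b" "a' b < b"
          using that a a' J(2) by (auto simp: space_Omega PiE_iff)
        have "(\<omega> b + t) mod b = a' b \<longleftrightarrow> [\<omega> b + t = a' b] (mod b)"
          using lt by (simp add: cong_def)
        also have "\<dots> \<longleftrightarrow> int b dvd int (\<omega> b) + int t - int (a' b)"
          by (simp add: cong_iff_dvd_diff flip: cong_int_iff)
        also have "int (\<omega> b) + int t - int (a' b) =
            (int (\<omega> b) - int (a b)) + (int t - (int (a' b) - int (a b)))" by simp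
        also have "int b dvd \<dots> \<longleftrightarrow> int b dvd int (\<omega> b) - int (a b)"
          using t[OF that(2)] by (rule dvd_add_left_iff)
        also have "\<dots> \<longleftrightarrow> [\<omega> b = a b] (mod b)"
          by (simp add: cong_iff_dvd_diff flip: cong_int_iff)
        also have "\<dots> \<longleftrightarrow> \<omega> b = a b" using lt by (simp add: cong_def)
        finally show ?thesis .
      qed
      then show ?thesis
        using J(2) funpow_rotation[of _ B _ t] funpow_rotation_in_space[OF _ B, of _ t]
        by (auto simp: pt_def cylinder_def sp subset_eq)
    qed
    then have "prob (pt a) = measure (distr \<mu> \<mu> (rotation B ^^ t)) (pt a')"
      by (simp add: measure_distr[OF Rt ptm])
    then show ?thesis by (simp add: invt)
  qed
  have ne: "(\<lambda>b\<in>J. 0) \<in> (\<Pi>\<^sub>E b\<in>J. {0..<b})" using J(2) B by force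
  define c where "c = prob (pt (\<lambda>b\<in>J. 0))"
  have cyl: "prob (cylinder B J A) = (\<Prod>b\<in>J. card (A b)) * c"
    if A: "\<And>b. b \<in> J \<Longrightarrow> A b \<subseteq> {0..<b}" for A
  proof -
    have fin: "finite (Pi\<^sub>E J A)"
      using J A by (intro finite_PiE) (auto intro: finite_subset)
    have sub: "Pi\<^sub>E J A \<subseteq> (\<Pi>\<^sub>E b\<in>J. {0..<b})" using A by (intro PiE_mono) auto
    have "cylinder B J A = (\<Union>a\<in>Pi\<^sub>E J A. pt a)"
    proof (intro set_eqI iffI)
      fix \<omega> assume "\<omega> \<in> cylinder B J A"
      then have "restrict \<omega> J \<in> Pi\<^sub>E J A" "\<omega> \<in> pt (restrict \<omega> J)"
        by (auto simp: cylinder_def pt_def)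
      then show "\<omega> \<in> (\<Union>a\<in>Pi\<^sub>E J A. pt a)" by blast
    qed (auto simp: cylinder_def pt_def)
    moreover have "disjoint_family_on pt (Pi\<^sub>E J A)"
      unfolding disjoint_family_on_def
    proof (intro ballI impI)
      fix a a' assume aa: "a \<in> Pi\<^sub>E J A" "a' \<in> Pi\<^sub>E J A" "a \<noteq> a'"
      then obtain b where "b \<in> J" "a b \<noteq> a' b" using PiE_ext[OF aa(1,2)] by blast
      then show "pt a \<inter> pt a' = {}" by (auto simp: pt_def cylinder_def)
    qed
    ultimately have "prob (cylinder B J A) = (\<Sum>a\<in>Pi\<^sub>E J A. prob (pt a))"
      using fin ptm by (simp add: finite_measure_finite_Union image_subset_iff)
    also have "\<dots> = (\<Sum>a\<in>Pi\<^sub>E J A. c)"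
      unfolding c_def using same[OF _ ne] sub by (intro sum.cong) auto
    also have "\<dots> = (\<Prod>b\<in>J. card (A b)) * c"
      by (simp add: card_PiE[OF J(1)])
    finally show ?thesis .
  qed
  \<comment> \<open>Full fibres give the whole space, and total mass 1 fixes the common mass
    \<open>c\<close>.\<close>
  have "cylinder B J (\<lambda>b. {0..<b}) = space \<mu>"
    using J(2) PiE_mem[of _ B "\<lambda>b. {0..<b}"] by (force simp: cylinder_def sp space_Omega)
  then have "1 = (\<Prod>b\<in>J. real b) * c"
    using cyl[of "\<lambda>b. {0..<b}"] prob_space by simp
  moreover have "(\<Prod>b\<in>J. real b) > 0" using J B by (intro prod_pos) force
  ultimately have "c = 1 / (\<Prod>b\<in>J. real b)" by (simp add: field_simps)
  then show "prob (cylinder B J A) = (\<Prod>b\<in>J. card (A b) / b)"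
    using cyl[OF A] by (simp add: prod_dividef)
qed

text \<open>Adding 1 permutes the residues modulo each \<open>b\<close>, so the preimage of a
  cylinder is a cylinder whose fibres have the same sizes.\<close>

lemma rotation_preserves_Omega:
  assumes B: "B \<subseteq> {1..}"
  shows "distr (Omega B) (Omega B) (rotation B) = Omega B"
proof (rule eq_Omega_if_cylinders[OF B])
  interpret prob_space "Omega B" by (rule prob_space_Omega[OF B])
  note R = measurable_rotation[OF B]
  show "prob_space (distr (Omega B) (Omega B) (rotation B))" by (rule prob_space_distr[OF R])
  fix J A assume J: "finite J" "J \<subseteq> B" and A: "\<And>b. b \<in> J \<Longrightarrow> A b \<subseteq> {0..<b}"
  define A' where "A' b = {n\<in>{0..<b}. (n + 1) mod b \<in> A b}" for b
  have card: "card (A' b) = card (A b)" if b: "b \<in> J" for b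
  proof -
    have b0: "b > 0" using b B J by force
    have "bij_betw (\<lambda>n. (n + 1) mod b) {0..<b} {0..<b}"
      unfolding bij_betw_def
    proof (rule context_conjI)
      show "inj_on (\<lambda>n. (n + 1) mod b) {0..<b}"
      proof (rule inj_onI)
        fix m n assume mn: "m \<in> {0..<b}" "n \<in> {0..<b}" "(m + 1) mod b = (n + 1) mod b"
        then have "[m + 1 = n + 1] (mod b)" by (simp only: cong_def)
        then have "[m = n] (mod b)" by (simp only: cong_add_rcancel_nat)
        then show "m = n" using mn by (simp add: cong_def)
      qed
      then show "(\<lambda>n. (n + 1) mod b) ` {0..<b} = {0..<b}"
        using b0 by (intro endo_inj_surj) auto
    qed
    moreover have "A' b \<subseteq> {0..<b}" by (auto simp: A'_def)
    moreover have "(\<lambda>n. (n + 1) mod b) ` A' b = A b"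
    proof
      show "A b \<subseteq> (\<lambda>n. (n + 1) mod b) ` A' b"
      proof
        fix m assume m: "m \<in> A b"
        then have "m \<in> (\<lambda>n. (n + 1) mod b) ` {0..<b}"
          using A[OF b] calculation(1) by (auto simp: bij_betw_def)
        then show "m \<in> (\<lambda>n. (n + 1) mod b) ` A' b" using m by (auto simp: A'_def)
      qed
    qed (auto simp: A'_def)
    ultimately have "bij_betw (\<lambda>n. (n + 1) mod b) (A' b) (A b)" by (rule bij_betw_subset)
    then show ?thesis by (rule bij_betw_same_card)
  qed
  have "rotation B -` cylinder B J A \<inter> space (Omega B) = cylinder B J A'"
  proof -
    have "\<omega> b < b" if "\<omega> \<in> space (Omega B)" "b \<in> J" for \<omega> b
      using that J(2) PiE_mem[of \<omega> B "\<lambda>b. {0..<b}" b] by (auto simp: space_Omega)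
    then show ?thesis
      using J(2) rotation_in_space[OF B]
      by (auto simp: cylinder_def A'_def rotation_def subset_eq)
  qed
  then have "measure (distr (Omega B) (Omega B) (rotation B)) (cylinder B J A) =
      measure (Omega B) (cylinder B J A')"
    by (simp add: measure_distr[OF R cylinder_sets[OF J]])
  also have "\<dots> = (\<Prod>b\<in>J. card (A b) / b)"
    using card by (subst measure_Omega_cylinder[OF B J]) (auto simp: A'_def)
  finally show "measure (distr (Omega B) (Omega B) (rotation B)) (cylinder B J A) =
      (\<Prod>b\<in>J. card (A b) / b)" .
qed simp

lemma ergodic_rotation:
  assumes B: "B \<subseteq> {1..}" and cop: "pairwise coprime B"
  shows "ergodic (Omega B) (rotation B)"
  unfolding ergodic_def invariant_measure_def
proof (intro conjI ballI impI)
  interpret prob_space "Omega B" by (rule prob_space_Omega[OF B])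
  show R[measurable]: "rotation B \<in> Omega B \<rightarrow>\<^sub>M Omega B" by (rule measurable_rotation[OF B])
  show inv: "distr (Omega B) (Omega B) (rotation B) = Omega B"
    by (rule rotation_preserves_Omega[OF B])
  fix A assume A[measurable]: "A \<in> sets (Omega B)" and RA: "rotation B -` A \<inter> space (Omega B) = A"
  show "emeasure (Omega B) A = 0 \<or> emeasure (Omega B) A = 1"
  proof (cases "emeasure (Omega B) A = 0")
    case False
    \<comment> \<open>the conditional measure on an invariant set is invariant, hence equal to the Haar measure\<close>
    let ?U = "uniform_measure (Omega B) A"
    have U: "prob_space ?U" using False by (intro prob_space_uniform_measure) auto
    have "distr ?U ?U (rotation B) = ?U"
    proof (rule measure_eqI)
      fix X assume "X \<in> sets (distr ?U ?U (rotation B))"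
      then have X[measurable]: "X \<in> sets (Omega B)" by simp
      let ?R = "rotation B -` X \<inter> space (Omega B)"
      have "A \<inter> ?R = rotation B -` (A \<inter> X) \<inter> space (Omega B)" using RA by blast
      then have "emeasure (Omega B) (A \<inter> ?R) = emeasure (distr (Omega B) (Omega B) (rotation B)) (A \<inter> X)"
        by (simp add: emeasure_distr)
      then have "emeasure (Omega B) (A \<inter> ?R) = emeasure (Omega B) (A \<inter> X)" by (simp add: inv)
      then show "emeasure (distr ?U ?U (rotation B)) X = emeasure ?U X"
        by (simp add: emeasure_distr)
    qed simp
    then have "?U = Omega B" using U by (intro rotation_uniquely_ergodic[OF B cop]) auto
    moreover have "emeasure ?U A = 1" using False by (intro emeasure_uniform_measure_1) auto
    ultimately show ?thesis by simp
  qed simp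
qed

section \<open>The shift space: measurability and the factor map \<open>phi\<close>\<close>

lemma space_SS: "space SS = UNIV"
  by (simp add: SS_def space_PiM)

lemma measurable_SS_component [measurable]: "(\<lambda>x. x n) \<in> SS \<rightarrow>\<^sub>M count_space UNIV"
  unfolding SS_def by measurable

lemma measurable_into_SS:
  assumes "\<And>n. (\<lambda>x. f x n) \<in> M \<rightarrow>\<^sub>M count_space UNIV"
  shows "f \<in> M \<rightarrow>\<^sub>M SS"
  using measurable_abs_UNIV[OF assms] by (simp add: SS_def)

lemma measurable_shift [measurable]: "shift \<in> SS \<rightarrow>\<^sub>M SS"
  by (rule measurable_into_SS) (simp add: shift_def)

lemma measurable_phi: "phi B \<in> Omega B \<rightarrow>\<^sub>M SS"
proof (rule measurable_into_SS)
  fix n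
  have "Measurable.pred (Omega B) (\<lambda>\<omega>. (int (\<omega> b) + n) mod int b \<noteq> 0)" if "b \<in> B" for b
    by (rule measurable_compose[OF measurable_component_Omega[OF that]]) simp
  then have "Measurable.pred (Omega B) (\<lambda>\<omega>. \<forall>b\<in>B. (int (\<omega> b) + n) mod int b \<noteq> 0)"
    by (intro pred_intros_countable_bounded(3)) auto
  then show "(\<lambda>\<omega>. phi B \<omega> n) \<in> Omega B \<rightarrow>\<^sub>M count_space UNIV"
    by (simp add: phi_def)
qed

lemma phi_rotation: "phi B (rotation B \<omega>) = shift (phi B \<omega>)"
proof -
  have "(int ((\<omega> b + 1) mod b) + n) mod int b = (int (\<omega> b) + (n + 1)) mod int b" for b n
    by (simp add: zmod_int mod_add_left_eq add.assoc add.commute[of 1])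
  then show ?thesis by (simp add: fun_eq_iff phi_def shift_def rotation_def)
qed

lemma sets_Xeta: "Xeta B \<in> sets SS"
proof -
  have "Measurable.pred SS (\<lambda>y. \<forall>m::int. \<forall>L::nat. \<exists>k::int. \<forall>j\<in>{..<L}. y (m + int j) = eta B (k + int j))"
    by measurable
  then show ?thesis
    by (simp add: Xeta_def pred_def space_SS Ball_def)
qed

section \<open>Missed residues\<close>

text \<open>The residue classes avoided by the support are kept as a \<open>b\<close>-periodic
  predicate on the integers rather than as a set of residues, so that the shift acts on it by plain
  translation.\<close>

definition missed :: "nat \<Rightarrow> (int \<Rightarrow> bool) \<Rightarrow> int \<Rightarrow> bool" where
  "missed b x n \<longleftrightarrow> (\<forall>k. \<not> x (n + k * int b))"

lemma missed_shift: "missed b (shift x) = (\<lambda>n. missed b x (n + 1))"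
  by (simp add: missed_def shift_def fun_eq_iff algebra_simps)

lemma missed_periodic: "missed b x (n + m * int b) = missed b x n"
proof -
  have "missed b x (n + m * int b)" if "missed b x n" for n m
    unfolding missed_def
  proof
    fix k
    have "n + m * int b + k * int b = n + (m + k) * int b" by (simp add: algebra_simps)
    then show "\<not> x (n + m * int b + k * int b)" using that unfolding missed_def by metis
  qed
  from this[of n m] this[of "n + m * int b" "- m"] show ?thesis by auto
qed

lemma measurable_missed [measurable]: "Measurable.pred SS (\<lambda>x. missed b x n)"
  unfolding missed_def by measurable

lemma measurable_missed_eq [measurable]: "Measurable.pred SS (\<lambda>x. missed b x = P)"
  unfolding fun_eq_iff by measurable

text \<open>If the support met every class mod \<open>b\<close>, a finite window would contain a one
  in each class. That window occurs in \<open>eta B\<close>, where one of these ones would sit on a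
  multiple of \<open>b\<close>.\<close>

lemma missed_nonempty:
  assumes x: "x \<in> Xeta B" and b: "b \<in> B" "b > 0"
  shows "\<exists>n. missed b x n"
proof (rule ccontr)
  assume "\<nexists>n. missed b x n"
  then have "\<forall>n. \<exists>k. x (n + k * int b)" by (simp add: missed_def)
  then obtain k where k: "\<And>n. x (n + k n * int b)" by metis
  define P where "P = (\<lambda>n. n + k n * int b) ` {0..<int b}"
  have P: "finite P" "P \<noteq> {}" using b by (auto simp: P_def)
  define m where "m = Min P"
  define L where "L = nat (Max P - m + 1)"
  obtain r where r: "\<And>j. j < L \<Longrightarrow> x (m + int j) = eta B (r + int j)"
    using x unfolding Xeta_def by blast
  \<comment> \<open>Copying the window into \<open>eta B\<close> sends position \<open>p\<close> to
    \<open>r + (p - m)\<close>; the class of \<open>m - r\<close> is the one that lands on multiples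
    of \<open>b\<close>.\<close>
  define n where "n = (m - r) mod int b"
  define p where "p = n + k n * int b"
  have "p \<in> P" using b by (auto simp: P_def p_def n_def)
  then have "m \<le> p" "p \<le> Max P" using P by (auto simp: m_def)
  then have "nat (p - m) < L" "m + int (nat (p - m)) = p" by (auto simp: L_def)
  then have "eta B (r + (p - m))" using r[of "nat (p - m)"] k[of n] \<open>m \<le> p\<close>
    by (simp flip: p_def)
  moreover have "int b dvd r + (p - m)"
  proof -
    have "int b dvd (m - r) mod int b - (m - r)"
      by (metis mod_eq_dvd_iff mod_mod_trivial)
    then have "int b dvd ((m - r) mod int b - (m - r)) + k n * int b" by simp
    then show ?thesis by (simp add: p_def n_def algebra_simps)
  qed
  ultimately show False using b by (auto simp: eta_def)
qed

text \<open>For finite \<open>B\<close>, a window of length \<open>\<Prod>B\<close> realises every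
  combination of residues. Inside \<open>eta B\<close> it thus has a one in every class mod
  \<open>b\<close> except that of the multiples of \<open>b\<close>, so at most one class can be
  missed.\<close>

lemma missed_unique:
  assumes adm: "admissible_B B" and fin: "finite B" and x: "x \<in> Xeta B" and b: "b \<in> B"
    and n: "missed b x n1" "missed b x n2"
  shows "int b dvd n1 - n2"
proof -
  have B: "B \<subseteq> {1..}" and B2: "B \<subseteq> {2..}" and cop: "pairwise coprime B" using adm by (auto simp: admissible_B_def)
  define N where "N = \<Prod>B"
  have N0: "N > 0" using B fin by (auto simp: N_def intro!: prod_pos)
  have dvdN: "int c dvd int N" if "c \<in> B" for c
    unfolding N_def int_dvd_int_iff using that fin dvd_prodI[of B c "\<lambda>x. x"] by simp
  obtain r where r: "\<And>j. j < N \<Longrightarrow> x (0 + int j) = eta B (r + int j)"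
    using x unfolding Xeta_def by blast
  have key: "int b dvd r + i" if mi: "missed b x i" for i
  proof (rule ccontr)
    assume nd: "\<not> int b dvd r + i"
    \<comment> \<open>The target \<open>1 - r\<close> makes \<open>r + q\<close> congruent to 1
      modulo every other \<open>c\<close>, so none of these divides it, while modulo
      \<open>b\<close> the position stays in the class of \<open>i\<close>. Reduction mod
      \<open>N\<close> then moves \<open>q\<close> into the window.\<close>
    obtain q :: nat where q: "\<And>c. c \<in> B \<Longrightarrow> int c dvd int q - (if c = b then i else 1 - r)"
      using crt_int[OF fin B cop, of "\<lambda>c. if c = b then i else 1 - r"] by blast
    define p where "p = q mod N"
    have p: "p < N" using N0 by (simp add: p_def)
    have pc: "int c dvd int p - (if c = b then i else 1 - r)" if c: "c \<in> B" for c
    proof -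
      have "int N dvd int p - int q"
        unfolding p_def by (metis mod_eq_dvd_iff mod_mod_trivial of_nat_mod)
      then have "int c dvd int p - int q" using dvdN[OF c] dvd_trans by blast
      from dvd_add[OF this q[OF c]] show ?thesis by simp
    qed
    have "eta B (r + int p)"
      unfolding eta_def
    proof
      fix c assume c: "c \<in> B"
      show "\<not> int c dvd r + int p"
      proof (cases "c = b")
        case True
        have "r + int p = (int p - i) + (r + i)" by simp
        then show ?thesis using pc[OF c] True nd by (metis dvd_add_right_iff)
      next
        case False
        have "r + int p = (int p - (1 - r)) + 1" by simp
        then have "int c dvd r + int p \<longleftrightarrow> int c dvd 1"
          using pc[OF c] False by (metis dvd_add_right_iff)
        then show ?thesis using B2 c by auto
      qed
    qed
    then have "x (int p)" using r[OF p] by simp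
    moreover obtain k where "int p = i + int b * k"
      using pc[OF b] by (auto simp: dvd_def algebra_simps)
    ultimately show False using mi by (auto simp: missed_def mult.commute)
  qed
  have "int b dvd (r + n1) - (r + n2)" using key n by (intro dvd_diff) auto
  then show ?thesis by simp
qed

section \<open>Least periods and almost sure constancy of the missed pattern\<close>

definition least_period :: "(int \<Rightarrow> bool) \<Rightarrow> nat" where
  "least_period A = (LEAST d. d > 0 \<and> (\<forall>n. A (n + int d) = A n))"

text \<open>The integer periods of \<open>A\<close> form a subgroup of the integers, generated by
  its least positive element. The assumed period \<open>b\<close> ensures that the
  \<open>LEAST\<close> is attained.\<close>

lemma
  assumes "b > 0" "\<And>n. A (n + int b) = A n"
  shows least_period_pos: "least_period A > 0"
    and least_period_mult: "A (n + m * int (least_period A)) = A n"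
    and least_period_dvd: "(\<And>n. A (n + p) = A n) \<Longrightarrow> int (least_period A) dvd p"
proof -
  let ?d = "least_period A"
  let ?Q = "\<lambda>d. d > 0 \<and> (\<forall>n. A (n + int d) = A n)"
  have Q: "?Q ?d"
    unfolding least_period_def by (rule LeastI[of ?Q b]) (use assms in auto)
  then show "?d > 0" by blast
  have step: "A (n + int k * int ?d) = A n" for n k
  proof (induction k)
    case (Suc k)
    have "A (n + int (Suc k) * int ?d) = A ((n + int k * int ?d) + int ?d)"
      by (simp add: algebra_simps)
    then show ?case using Q Suc by simp
  qed simp
  show per: "A (n + m * int ?d) = A n" for n m
  proof (cases "m \<ge> 0")
    case True
    then show ?thesis using step[of n "nat m"] by simp
  next
    case False
    then show ?thesis using step[of "n + m * int ?d" "nat (- m)"] by simp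
  qed
  show "int ?d dvd p" if p: "\<And>n. A (n + p) = A n"
  proof (rule ccontr)
    assume "\<not> int ?d dvd p"
    \<comment> \<open>The remainder of a period is again a period, and it is smaller than
      \<open>?d\<close>; if nonzero it would contradict minimality.\<close>
    define e where "e = nat (p mod int ?d)"
    have e: "int e = p mod int ?d" using \<open>?d > 0\<close> by (simp add: e_def)
    have "e > 0" using \<open>\<not> int ?d dvd p\<close> \<open>?d > 0\<close>
      by (metis dvd_eq_mod_eq_0 e gr0I of_nat_0)
    moreover have "A (n + int e) = A n" for n
    proof -
      have "n + int e = (n + p) + (- (p div int ?d)) * int ?d"
        by (simp add: e minus_div_mult_eq_mod[symmetric])
      then show ?thesis by (simp only: per p)
    qed
    ultimately have "?d \<le> e" unfolding least_period_def by (intro Least_le) auto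
    moreover have "int e < int ?d" using \<open>?d > 0\<close> by (simp add: e)
    ultimately show False by simp
  qed
qed

text \<open>Having a translate of \<open>P\<close> as missed pattern is a shift-invariant event,
  hence of mass 0 or 1. Countably many such events cover the space, so they cannot all be
  null.\<close>

lemma missed_pattern_constant:
  assumes "prob_space \<nu>" and sets: "sets \<nu> = sets SS" and erg: "ergodic \<nu> shift" and b: "b > 0"
  obtains P where "AE x in \<nu>. \<exists>s. missed b x = (\<lambda>n. P (n + s))"
proof -
  interpret prob_space \<nu> by fact
  note [measurable_cong] = sets
  have sp: "space \<nu> = UNIV" using sets_eq_imp_space_eq[OF sets] by (simp add: space_SS)
  define E where "E P = {x. \<exists>s. missed b x = (\<lambda>n. P (n + s))}" for P
  have E: "E P \<in> sets \<nu>" for P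
  proof -
    have "Measurable.pred \<nu> (\<lambda>x. \<exists>s::int. missed b x = (\<lambda>n. P (n + s)))" by measurable
    then show ?thesis by (simp add: pred_def sp E_def)
  qed
  have zo: "emeasure \<nu> (E P) = 0 \<or> emeasure \<nu> (E P) = 1" for P
  proof -
    have "shift x \<in> E P \<longleftrightarrow> x \<in> E P" for x
    proof
      assume "x \<in> E P"
      then obtain s where "missed b x = (\<lambda>n. P (n + s))" by (auto simp: E_def)
      then have "missed b (shift x) = (\<lambda>n. P (n + (1 + s)))" by (simp add: missed_shift add.assoc)
      then show "shift x \<in> E P" by (auto simp: E_def)
    next
      assume "shift x \<in> E P"
      then obtain s where s: "missed b (shift x) = (\<lambda>n. P (n + s))" by (auto simp: E_def)
      have "missed b x n = P (n + (s - 1))" for n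
        using fun_cong[OF s, of "n - 1"] by (simp add: missed_shift algebra_simps)
      then show "x \<in> E P" by (auto simp: E_def)
    qed
    then have "shift -` E P \<inter> space \<nu> = E P" by (auto simp: sp)
    then show ?thesis using erg E unfolding ergodic_def by blast
  qed
  \<comment> \<open>Patterns are coded by boolean lists because these form a countable type. Those
    of length \<open>b\<close> suffice for the cover, and other lengths do no harm.\<close>
  define D where "D l = (\<lambda>n. l ! nat (n mod int b))" for l :: "bool list"
  have cover: "\<exists>l. x \<in> E (D l)" for x
  proof
    let ?l = "map (\<lambda>i. missed b x (int i)) [0..<b]"
    have "missed b x n = D ?l (n + 0)" for n
    proof -
      have "missed b x n = missed b x (n mod int b + (n div int b) * int b)" by simp
      also have "\<dots> = missed b x (n mod int b)" by (rule missed_periodic)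
      also have "\<dots> = D ?l (n + 0)" using b by (simp add: D_def nat_less_iff)
      finally show ?thesis .
    qed
    then show "x \<in> E (D ?l)" unfolding E_def by blast
  qed
  have "\<not> (\<forall>l. emeasure \<nu> (E (D l)) = 0)"
  proof
    assume "\<forall>l. emeasure \<nu> (E (D l)) = 0"
    then have "AE x in \<nu>. x \<notin> E (D l)" for l
      using E by (intro AE_not_in) auto
    then have "AE x in \<nu>. \<forall>l. x \<notin> E (D l)" by (simp add: AE_all_countable)
    then have "AE x in \<nu>. False" by eventually_elim (use cover in blast)
    then show False by simp
  qed
  then obtain l where "emeasure \<nu> (E (D l)) = 1" using zo by blast
  then have "AE x in \<nu>. x \<in> E (D l)"
    using E by (simp add: AE_in_set_eq_1 emeasure_eq_measure)
  then show thesis by (intro that[of "D l"]) (simp add: E_def)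
qed

text \<open>This packages the equivariant map to the odometer coordinate by coordinate:
  \<open>\<tau> b x\<close> is the translation carrying the model pattern to that of
  \<open>x\<close>, determined mod \<open>d b\<close> because only multiples of \<open>d b\<close>
  fix the model. The model contains 0, so a position \<open>n\<close> with \<open>d b\<close>
  dividing \<open>\<tau> b x + n\<close> is missed by \<open>x\<close>.\<close>

lemma exists_residue_map:
  assumes adm: "admissible_B B" and prob: "prob_space \<nu>" and sets: "sets \<nu> = sets SS"
    and X: "emeasure \<nu> (Xeta B) = 1" and erg: "ergodic \<nu> shift"
    and nz: "\<not> (AE x in \<nu>. \<not> x 0)"
  obtains d :: "nat \<Rightarrow> nat" and \<tau> :: "nat \<Rightarrow> (int \<Rightarrow> bool) \<Rightarrow> nat" and G
  where "\<And>b. b \<in> B \<Longrightarrow> d b dvd b" "\<And>b. b \<in> B \<Longrightarrow> d b \<ge> 2"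
    "infinite B \<or> (\<forall>b\<in>B. d b = b)"
    "G \<in> sets \<nu>" "AE x in \<nu>. x \<in> G" "\<And>x. shift x \<in> G \<longleftrightarrow> x \<in> G"
    "\<And>b. b \<in> B \<Longrightarrow> \<tau> b \<in> \<nu> \<rightarrow>\<^sub>M count_space UNIV"
    "\<And>b x. b \<in> B \<Longrightarrow> \<tau> b x < d b"
    "\<And>b x. b \<in> B \<Longrightarrow> x \<in> G \<Longrightarrow> \<tau> b (shift x) = (\<tau> b x + 1) mod d b"
    "\<And>b x n. b \<in> B \<Longrightarrow> x \<in> G \<Longrightarrow> x n \<Longrightarrow> \<not> int (d b) dvd int (\<tau> b x) + n"
proof -
  interpret prob_space \<nu> by fact
  note [measurable_cong] = sets
  have sp: "space \<nu> = UNIV" using sets_eq_imp_space_eq[OF sets] by (simp add: space_SS)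
  have B: "B \<subseteq> {1..}" using adm by (auto simp: admissible_B_def)
  have b0: "b > 0" if "b \<in> B" for b using that B by auto
  have "\<exists>P. AE x in \<nu>. \<exists>s. missed b x = (\<lambda>n. P (n + s))" if "b \<in> B" for b
    using missed_pattern_constant[OF prob sets erg b0[OF that]] by blast
  then have "\<forall>b\<in>B. \<exists>P. AE x in \<nu>. \<exists>s. missed b x = (\<lambda>n. P (n + s))" by blast
  from bchoice[OF this] obtain P
    where P: "\<forall>b\<in>B. AE x in \<nu>. \<exists>s. missed b x = (\<lambda>n. P b (n + s))" ..
  have AE_P: "AE x in \<nu>. \<forall>b\<in>B. \<exists>s. missed b x = (\<lambda>n. P b (n + s))"
    by (rule AE_ball_countable'[OF bspec[OF P]]) auto
  moreover have "AE x in \<nu>. x \<in> Xeta B"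
    using X by (intro AE_prob_1) (simp add: measure_def)
  ultimately have AE_x0: "AE x in \<nu>. x \<in> Xeta B \<and> (\<forall>b\<in>B. \<exists>s. missed b x = (\<lambda>n. P b (n + s)))"
    by eventually_elim simp
  \<comment> \<open>An almost sure property has a witness. One point of \<open>Xeta B\<close> then
    represents the patterns for all \<open>b\<close> at once, and \<open>missed_nonempty\<close> and
    \<open>missed_unique\<close> apply to it.\<close>
  have "\<exists>x. x \<in> Xeta B \<and> (\<forall>b\<in>B. \<exists>s. missed b x = (\<lambda>n. P b (n + s)))"
  proof (rule ccontr)
    assume "\<not> ?thesis"
    then have "AE x in \<nu>. False" using AE_x0 by (simp only: not_ex)
    then show False by simp
  qed
  then obtain x0 where x0: "x0 \<in> Xeta B" "\<forall>b\<in>B. \<exists>s. missed b x0 = (\<lambda>n. P b (n + s))"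
    by (elim exE conjE) (rule that)
  have "\<forall>b\<in>B. \<exists>n. missed b x0 n" using missed_nonempty[OF x0(1)] b0 by blast
  then obtain n0 where n0: "\<And>b. b \<in> B \<Longrightarrow> missed b x0 (n0 b)" by metis
  \<comment> \<open>Recentring at a missed position puts 0 into every model pattern.\<close>
  define A where "A b = (\<lambda>n. missed b x0 (n + n0 b))" for b
  have A0: "A b 0" if "b \<in> B" for b using n0[OF that] by (simp add: A_def)
  have Ab: "A b (n + int b) = A b n" for b n
    using missed_periodic[of b x0 "n + n0 b" 1] by (simp add: A_def algebra_simps)
  define d where "d b = least_period (A b)" for b
  have d0: "d b > 0" if "b \<in> B" for b
    unfolding d_def by (rule least_period_pos[of b]) (use b0[OF that] Ab in auto)
  have dper: "A b (n + m * int (d b)) = A b n" if "b \<in> B" for b n m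
    unfolding d_def by (rule least_period_mult[of b]) (use b0[OF that] Ab in auto)
  have ddvd: "int (d b) dvd p" if "b \<in> B" "\<And>n. A b (n + p) = A b n" for b p
    unfolding d_def by (rule least_period_dvd[of b]) (use b0[OF that(1)] Ab that(2) in auto)
  \<comment> \<open>Allowing an arbitrary translation \<open>s\<close> makes \<open>G\<close>
    exactly shift-invariant, as \<open>ergodic_distr\<close> requires.\<close>
  define G where "G = {x. \<forall>b\<in>B. \<exists>s::int. missed b x = (\<lambda>n. A b (n + s))}"
  have G_sets: "G \<in> sets \<nu>"
  proof -
    have "Measurable.pred \<nu> (\<lambda>x. \<forall>b\<in>B. \<exists>s::int. missed b x = (\<lambda>n. A b (n + s)))"
      by measurable
    then show ?thesis by (simp add: pred_def sp G_def)
  qed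
  have AE_G: "AE x in \<nu>. x \<in> G"
    using AE_P
  proof eventually_elim
    case (elim x)
    have "\<exists>s. missed b x = (\<lambda>n. A b (n + s))" if b: "b \<in> B" for b
    proof -
      obtain s where s: "missed b x = (\<lambda>n. P b (n + s))" using elim b by blast
      obtain s0 where s0: "missed b x0 = (\<lambda>n. P b (n + s0))" using x0(2) b by blast
      have "missed b x = (\<lambda>n. A b (n + (s - s0 - n0 b)))" by (simp add: A_def s s0)
      then show ?thesis by blast
    qed
    then show ?case by (simp add: G_def)
  qed
  have G_shift: "shift x \<in> G \<longleftrightarrow> x \<in> G" for x
  proof -
    have "(\<exists>s. missed b (shift x) = (\<lambda>n. A b (n + s))) \<longleftrightarrow> (\<exists>s. missed b x = (\<lambda>n. A b (n + s)))" for b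
    proof safe
      fix s assume s: "missed b (shift x) = (\<lambda>n. A b (n + s))"
      have "missed b x n = A b (n + (s - 1))" for n
        using fun_cong[OF s, of "n - 1"] by (simp add: missed_shift algebra_simps)
      then show "\<exists>s. missed b x = (\<lambda>n. A b (n + s))" by blast
    next
      fix s assume "missed b x = (\<lambda>n. A b (n + s))"
      then have "missed b (shift x) = (\<lambda>n. A b (n + (1 + s)))" by (simp add: missed_shift add.assoc)
      then show "\<exists>s. missed b (shift x) = (\<lambda>n. A b (n + s))" by blast
    qed
    then show ?thesis by (simp add: G_def)
  qed
  \<comment> \<open>the outer reduction only matters outside \<open>G\<close>, where the \<open>LEAST\<close> may be a junk value\<close>
  define \<tau> where "\<tau> b x = (LEAST t. missed b x = (\<lambda>n. A b (n + int t))) mod d b" for b x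
  have \<tau>_meas: "\<tau> b \<in> \<nu> \<rightarrow>\<^sub>M count_space UNIV" for b
    unfolding \<tau>_def by measurable
  have \<tau>_lt: "\<tau> b x < d b" if "b \<in> B" for b x using d0[OF that] by (simp add: \<tau>_def)
  have \<tau>_eq: "missed b x = (\<lambda>n. A b (n + int (\<tau> b x)))" if b: "b \<in> B" and x: "x \<in> G" for b x
  proof -
    have red: "A b (n + s mod int (d b)) = A b (n + s)" for n s
      using dper[OF b, of "n + s mod int (d b)" "s div int (d b)"] by (simp add: add.assoc)
    obtain s where s: "missed b x = (\<lambda>n. A b (n + s))" using b x by (auto simp: G_def)
    have "missed b x = (\<lambda>n. A b (n + int (nat (s mod int (d b)))))"
      using d0[OF b] by (simp add: s red)
    then have "missed b x = (\<lambda>n. A b (n + int (LEAST t. missed b x = (\<lambda>n. A b (n + int t)))))"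
      by (rule LeastI)
    then show ?thesis by (simp add: \<tau>_def of_nat_mod red)
  qed
  have \<tau>_unique: "int (d b) dvd s - int (\<tau> b x)"
    if b: "b \<in> B" and x: "x \<in> G" and s: "missed b x = (\<lambda>n. A b (n + s))" for b x s
  proof (rule ddvd[OF b])
    fix n
    show "A b (n + (s - int (\<tau> b x))) = A b n"
      using fun_cong[OF s, of "n - int (\<tau> b x)"] fun_cong[OF \<tau>_eq[OF b x], of "n - int (\<tau> b x)"]
      by (simp add: algebra_simps)
  qed
  show thesis
  proof (rule that[of d G \<tau>])
    show d_dvd: "d b dvd b" if "b \<in> B" for b
      using ddvd[OF that Ab] by simp
    show "d b \<ge> 2" if b: "b \<in> B" for b
    proof (rule ccontr)
      assume "\<not> d b \<ge> 2"
      \<comment> \<open>A pattern of period 1 containing 0 is everything, so almost every point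
        would vanish at 0, against the assumption \<open>nz\<close>.\<close>
      then have "d b = 1" using d0[OF b] by simp
      then have "A b n" for n using dper[OF b, of 0 n] A0[OF b] by simp
      then have G0: "\<not> x 0" if "x \<in> G" for x
      proof -
        have "missed b x 0" using \<open>\<And>n. A b n\<close> by (simp add: \<tau>_eq[OF b that])
        then have "\<not> x (0 + 0 * int b)" unfolding missed_def by blast
        then show ?thesis by simp
      qed
      have "AE x in \<nu>. \<not> x 0" using AE_G by eventually_elim (rule G0)
      then show False using nz by blast
    qed
    \<comment> \<open>Both 0 and \<open>d b\<close> lie in \<open>A b\<close>; as a finite
      \<open>B\<close> leaves room for only one missed class, \<open>b\<close> divides their
      difference.\<close>
    have "d b = b" if fin: "finite B" and b: "b \<in> B" for b
    proof -
      have "A b (0 + 1 * int (d b))" using A0[OF b] dper[OF b] by blast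
      then have "int b dvd (int (d b) + n0 b) - n0 b"
        by (intro missed_unique[OF adm fin x0(1) b _ n0[OF b]]) (simp add: A_def)
      then have "b dvd d b" by simp
      then show "d b = b" using d_dvd[OF b] by (simp add: dvd_antisym)
    qed
    then show "infinite B \<or> (\<forall>b\<in>B. d b = b)" by blast
    show "\<tau> b (shift x) = (\<tau> b x + 1) mod d b" if b: "b \<in> B" and x: "x \<in> G" for b x
    proof -
      have "missed b (shift x) = (\<lambda>n. A b (n + int (\<tau> b x + 1)))"
        unfolding missed_shift \<tau>_eq[OF b x] by (simp add: algebra_simps)
      moreover have "shift x \<in> G" using x G_shift by blast
      ultimately have "int (d b) dvd int (\<tau> b x + 1) - int (\<tau> b (shift x))"
        by (intro \<tau>_unique[OF b])
      then have "[\<tau> b x + 1 = \<tau> b (shift x)] (mod d b)"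
        by (simp only: cong_iff_dvd_diff flip: cong_int_iff)
      then show ?thesis using \<tau>_lt[OF b, of "shift x"] by (simp add: cong_def)
    qed
    show "\<not> int (d b) dvd int (\<tau> b x) + n" if b: "b \<in> B" and x: "x \<in> G" and xn: "x n" for b x n
    proof
      assume "int (d b) dvd int (\<tau> b x) + n"
      then obtain m where "n + int (\<tau> b x) = 0 + m * int (d b)"
        by (auto simp: dvd_def algebra_simps)
      then have "missed b x n" using A0[OF b] dper[OF b, of 0 m] by (simp add: \<tau>_eq[OF b x])
      then show False using xn by (auto simp: missed_def dest: spec[of _ 0])
    qed
  qed (fact G_sets AE_G G_shift | rule \<tau>_meas | erule \<tau>_lt)+
qed

section \<open>The joining\<close>

text \<open>Equal values of \<open>d\<close> at distinct elements would be coprime to themselves,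
  which is impossible from 2 on. Injectivity is what lets a coordinate \<open>d b\<close> of the new
  odometer be traced back to \<open>b\<close>.\<close>

lemma divisors_pairwise_coprime:
  assumes adm: "admissible_B B" and d: "\<And>b. b \<in> B \<Longrightarrow> d b dvd b" "\<And>b. b \<in> B \<Longrightarrow> d b \<ge> (2::nat)"
  shows "pairwise coprime (d ` B)" "inj_on d B"
proof -
  have cop: "coprime (d b) (d c)" if "b \<in> B" "c \<in> B" "b \<noteq> c" for b c
    using that adm d(1) coprime_divisors[of "d b" b "d c" c] by (auto simp: admissible_B_def pairwise_def)
  show "pairwise coprime (d ` B)"
    unfolding pairwise_def using cop by blast
  show "inj_on d B"
  proof (rule inj_onI, rule ccontr)
    fix b c assume "b \<in> B" "c \<in> B" "d b = d c" "b \<noteq> c"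
    then have "coprime (d b) (d b)" using cop[of b c] by simp
    then show False using d(2)[OF \<open>b \<in> B\<close>] by simp
  qed
qed

text \<open>The cylinder has measure \<open>\<Prod>(1 - 1 / b)\<close>, at most
  \<open>exp (- \<Sum>1 / b)\<close>, so every finite partial sum is bounded by
  \<open>- ln p\<close>.\<close>

lemma summable_if_missing_zero_positive:
  assumes B: "B \<subseteq> {1..}" and p: "p > 0"
    and le: "\<And>F. finite F \<Longrightarrow> F \<subseteq> B \<Longrightarrow> p \<le> measure (Omega B) (cylinder B F (\<lambda>b. {1..<b}))"
  shows "(\<lambda>b. 1 / real b) summable_on B"
proof (rule nonneg_bounded_partial_sums_imp_summable_on)
  show "\<forall>\<^sub>F F in finite_subsets_at_top B. (\<Sum>b\<in>F. 1 / real b) \<le> - ln p"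
  proof (rule eventually_finite_subsets_at_top_weakI)
    fix F assume F: "finite F" "F \<subseteq> B"
    have "p \<le> (\<Prod>b\<in>F. card {1..<b} / b)"
      using le[OF F] measure_Omega_cylinder[OF B F, of "\<lambda>b. {1..<b}"] by force
    also have "\<dots> \<le> (\<Prod>b\<in>F. exp (- (1 / real b)))"
    proof (rule prod_mono, safe)
      fix b assume "b \<in> F"
      then have "b > 0" using F B by force
      then have "card {1..<b} / b = 1 + - (1 / real b)" by (simp add: field_simps of_nat_diff)
      also have "\<dots> \<le> exp (- (1 / real b))" by (rule exp_ge_add_one_self)
      finally show "card {1..<b} / b \<le> exp (- (1 / real b))" .
    qed simp
    also have "\<dots> = exp (- (\<Sum>b\<in>F. 1 / real b))"
      by (simp add: exp_sum[OF F(1)] flip: sum_negf)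
    finally have "ln p \<le> ln (exp (- (\<Sum>b\<in>F. 1 / real b)))"
      using p by (subst ln_le_cancel_iff) auto
    then show "(\<Sum>b\<in>F. 1 / real b) \<le> - ln p" by simp
  qed
qed simp

lemma prob_space_mirsky: "B \<subseteq> {1..} \<Longrightarrow> prob_space (mirsky B)"
  unfolding mirsky_def by (intro prob_space.prob_space_distr prob_space_Omega measurable_phi)

lemma ergodic_mirsky:
  assumes "B \<subseteq> {1..}" "pairwise coprime B"
  shows "ergodic (mirsky B) shift"
  unfolding mirsky_def
proof (rule ergodic_distr[OF ergodic_rotation[OF assms] measurable_phi measurable_shift sets.top])
  show "rotation B \<omega> \<in> space (Omega B) \<longleftrightarrow> \<omega> \<in> space (Omega B)" if "\<omega> \<in> space (Omega B)" for \<omega>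
    using that rotation_in_space[OF assms(1)] by simp
qed (auto simp: phi_rotation)

lemma measurable_shift_pair: "(\<lambda>(x, u). (shift x, shift u)) \<in> SS \<Otimes>\<^sub>M SS \<rightarrow>\<^sub>M SS \<Otimes>\<^sub>M SS"
  by measurable

lemma measurable_conj_SS: "(\<lambda>(x, u). (\<lambda>n. x n \<and> u n)) \<in> SS \<Otimes>\<^sub>M SS \<rightarrow>\<^sub>M SS"
  by (rule measurable_into_SS) (simp add: case_prod_beta)

text \<open>The degenerate case: \<open>\<nu>\<close> is the point mass at the zero sequence.
  Pairing the Mirsky measure of \<open>B\<close> with the constant zero sequence makes every product
  zero.\<close>

lemma extension_of_zero_measure:
  assumes adm: "admissible_B B" and prob: "prob_space \<nu>" and sets: "sets \<nu> = sets SS"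
    and erg: "ergodic \<nu> shift" and z: "AE x in \<nu>. \<not> x 0"
  defines "\<rho> \<equiv> distr (mirsky B) (SS \<Otimes>\<^sub>M SS) (\<lambda>x. (x, \<lambda>_. False))"
  shows "prob_space \<rho>" "sets \<rho> = sets (SS \<Otimes>\<^sub>M SS)" "emeasure \<rho> (Xeta B \<times> UNIV) = 1"
    "ergodic \<rho> (\<lambda>(x, u). (shift x, shift u))" "distr \<rho> SS fst = mirsky B"
    "distr \<rho> SS (\<lambda>(x, u). (\<lambda>n. x n \<and> u n)) = \<nu>"
proof -
  interpret prob_space \<nu> by fact
  note [measurable_cong] = sets
  have B: "B \<subseteq> {1..}" "pairwise coprime B" using adm by (auto simp: admissible_B_def)
  interpret m: prob_space "mirsky B" by (rule prob_space_mirsky[OF B(1)])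
  have m_sets [measurable_cong]: "sets (mirsky B) = sets SS" by (simp add: mirsky_def)
  have m_space: "space (mirsky B) = UNIV" by (simp add: mirsky_def space_SS)
  have emb: "(\<lambda>x. (x, \<lambda>_. False)) \<in> mirsky B \<rightarrow>\<^sub>M SS \<Otimes>\<^sub>M SS"
    by (intro measurable_Pair) (auto intro: measurable_into_SS)
  show "prob_space \<rho>" unfolding \<rho>_def by (rule m.prob_space_distr[OF emb])
  show "sets \<rho> = sets (SS \<Otimes>\<^sub>M SS)" by (simp add: \<rho>_def)
  have "emeasure \<rho> (Xeta B \<times> UNIV) = emeasure (mirsky B) (Xeta B)"
    unfolding \<rho>_def using sets_Xeta[of B] sets.top[of SS]
    by (subst emeasure_distr[OF emb]) (auto simp: space_SS m_space intro!: arg_cong2[where f = emeasure])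
  also have "\<dots> = emeasure (Omega B) (space (Omega B))"
    unfolding mirsky_def using phi_in_Xeta[OF adm, of "\<lambda>b. b"]
    by (subst emeasure_distr[OF measurable_phi sets_Xeta]) (auto intro!: arg_cong2[where f = emeasure])
  also have "\<dots> = 1" by (rule prob_space.emeasure_space_1[OF prob_space_Omega[OF B(1)]])
  finally show "emeasure \<rho> (Xeta B \<times> UNIV) = 1" .
  show "ergodic \<rho> (\<lambda>(x, u). (shift x, shift u))"
    unfolding \<rho>_def
    by (rule ergodic_distr[OF ergodic_mirsky[OF B] emb measurable_shift_pair sets.top])
       (auto simp: m_space shift_def)
  have "distr \<rho> SS fst = distr (mirsky B) SS (\<lambda>x. x)"
    unfolding \<rho>_def by (subst distr_distr[OF _ emb]) (auto simp: comp_def)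
  then show "distr \<rho> SS fst = mirsky B" by (simp add: distr_id2 m_sets)
  let ?z = "\<lambda>_. (\<lambda>_. False) :: int \<Rightarrow> bool"
  have zm: "?z \<in> M \<rightarrow>\<^sub>M SS" for M :: "(int \<Rightarrow> bool) measure" by (intro measurable_const) (simp add: space_SS)
  have "distr \<rho> SS (\<lambda>(x, u). (\<lambda>n. x n \<and> u n)) = distr (mirsky B) SS ?z"
    unfolding \<rho>_def by (subst distr_distr[OF measurable_conj_SS emb]) (simp add: comp_def)
  also have "\<dots> = return SS (\<lambda>_. False)" by (rule m.distr_const) (simp add: space_SS)
  \<comment> \<open>A constant map has the same image under every probability measure, so the point
    mass can be rewritten as an image of \<open>\<nu>\<close>; it remains to see that almost every
    \<open>x\<close> is the zero sequence.\<close>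
  also have "\<dots> = distr \<nu> SS ?z" by (rule distr_const[symmetric]) (simp add: space_SS)
  also have "\<dots> = distr \<nu> SS (\<lambda>x. x)"
  proof (rule distr_cong_AE)
    have T: "shift \<in> \<nu> \<rightarrow>\<^sub>M \<nu>" and inv: "distr \<nu> \<nu> shift = \<nu>"
      using erg by (auto simp: ergodic_def invariant_measure_def)
    \<comment> \<open>Invariance carries the vanishing at coordinate 0 to all coordinates, one step
      at a time in both directions.\<close>
    have up: "AE x in \<nu>. \<not> x (n + 1)" if "AE x in \<nu>. \<not> x n" for n
    proof -
      have "AE x in distr \<nu> \<nu> shift. \<not> x n" unfolding inv by (rule that)
      then show ?thesis using T by (subst (asm) AE_distr_iff) (auto simp: shift_def)
    qed
    have down: "AE x in \<nu>. \<not> x (n - 1)" if "AE x in \<nu>. \<not> x n" for n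
    proof -
      have "AE x in \<nu>. \<not> shift x (n - 1)" using that by (simp add: shift_def)
      then have "AE x in distr \<nu> \<nu> shift. \<not> x (n - 1)" using T by (subst AE_distr_iff) auto
      then show ?thesis unfolding inv .
    qed
    have "AE x in \<nu>. \<not> x n" for n
      by (induction n rule: int_induct[where k = 0]) (use z up down in auto)
    then have "AE x in \<nu>. \<forall>n. \<not> x n" by (simp add: AE_all_countable)
    then show "AE x in \<nu>. (\<lambda>_. False) = x" by eventually_elim auto
  qed (auto simp: zm)
  also have "\<dots> = \<nu>" by (simp add: distr_id2 sets)
  finally show "distr \<rho> SS (\<lambda>(x, u). (\<lambda>n. x n \<and> u n)) = \<nu>" .
qed

theorem theorem2:
  fixes B :: "nat set" and \<nu> :: "(int \<Rightarrow> bool) measure"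
  assumes "admissible_B B"
    and "prob_space \<nu>" and "sets \<nu> = sets SS" and "emeasure \<nu> (Xeta B) = 1"
    and "ergodic \<nu> shift"
  shows "\<exists>B' (\<rho> :: ((int \<Rightarrow> bool) \<times> (int \<Rightarrow> bool)) measure).
           admissible_B B' \<and> Xeta B' \<subseteq> Xeta B \<and>
           prob_space \<rho> \<and> sets \<rho> = sets (SS \<Otimes>\<^sub>M SS) \<and>
           emeasure \<rho> (Xeta B \<times> UNIV) = 1 \<and>
           ergodic \<rho> (\<lambda>(x, u). (shift x, shift u)) \<and>
           distr \<rho> SS fst = mirsky B' \<and>
           distr \<rho> SS (\<lambda>(x, u). (\<lambda>n. x n \<and> u n)) = \<nu>"
proof (cases "AE x in \<nu>. \<not> x 0")
  case True
  then show ?thesis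
    using extension_of_zero_measure[OF assms(1,2,3,5)] assms(1) by blast
next
  case False
  note adm = assms(1) and prob = assms(2) and sets = assms(3) and erg = assms(5)
  obtain d :: "nat \<Rightarrow> nat" and \<tau> :: "nat \<Rightarrow> (int \<Rightarrow> bool) \<Rightarrow> nat" and G
    where d: "\<And>b. b \<in> B \<Longrightarrow> d b dvd b" "\<And>b. b \<in> B \<Longrightarrow> d b \<ge> 2"
      and inf: "infinite B \<or> (\<forall>b\<in>B. d b = b)"
      and G: "G \<in> sets \<nu>" "AE x in \<nu>. x \<in> G" "\<And>x. shift x \<in> G \<longleftrightarrow> x \<in> G"
      and \<tau>_meas: "\<And>b. b \<in> B \<Longrightarrow> \<tau> b \<in> \<nu> \<rightarrow>\<^sub>M count_space UNIV"
      and \<tau>_lt: "\<And>b x. b \<in> B \<Longrightarrow> \<tau> b x < d b"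
      and \<tau>_shift: "\<And>b x. b \<in> B \<Longrightarrow> x \<in> G \<Longrightarrow> \<tau> b (shift x) = (\<tau> b x + 1) mod d b"
      and \<tau>_missed: "\<And>b x n. b \<in> B \<Longrightarrow> x \<in> G \<Longrightarrow> x n \<Longrightarrow> \<not> int (d b) dvd int (\<tau> b x) + n"
    by (rule exists_residue_map[OF assms False]) (rule that)
  interpret prob_space \<nu> by fact
  note [measurable_cong] = sets
  have sp: "space \<nu> = UNIV" using sets_eq_imp_space_eq[OF sets] by (simp add: space_SS)
  let ?B' = "d ` B"
  have B': "?B' \<subseteq> {1..}" "?B' \<subseteq> {2..}" using d(2) by force+
  note cop = divisors_pairwise_coprime(1)[OF adm d] and inj = divisors_pairwise_coprime(2)[OF adm d]
  \<comment> \<open>Coordinates of \<open>Omega ?B'\<close> are indexed by the divisors themselves,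
    hence the inverse of \<open>d\<close>; outside \<open>?B'\<close> the restriction gives the
    default value that points of a product space must have.\<close>
  define \<theta> where "\<theta> x = (\<lambda>c\<in>?B'. \<tau> (inv_into B d c) x)" for x
  have \<theta>: "\<theta> x (d b) = \<tau> b x" if "b \<in> B" for x b
    using that by (simp add: \<theta>_def inv_into_f_f[OF inj])
  have \<theta>_meas: "\<theta> \<in> \<nu> \<rightarrow>\<^sub>M Omega ?B'"
  proof (rule measurable_into_Omega)
    show "(\<lambda>x. \<theta> x c) \<in> \<nu> \<rightarrow>\<^sub>M count_space UNIV" if c: "c \<in> ?B'" for c
    proof -
      obtain b where b: "b \<in> B" "c = d b" using c by blast
      then have "(\<lambda>x. \<theta> x c) = \<tau> b" using \<theta> by auto
      then show ?thesis using \<tau>_meas[OF b(1)] by simp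
    qed
    show "\<theta> x \<in> space (Omega ?B')" for x
      using \<theta> \<tau>_lt by (auto simp: space_Omega PiE_iff) (simp add: \<theta>_def extensional_def)
  qed
  have \<theta>_shift: "\<theta> (shift x) = rotation ?B' (\<theta> x)" if "x \<in> G" for x
  proof
    fix c
    show "\<theta> (shift x) c = rotation ?B' (\<theta> x) c"
      using \<tau>_shift[OF _ that] \<theta> by (cases "c \<in> ?B'") (auto simp: rotation_def \<theta>_def)
  qed
  have le: "phi ?B' (\<theta> x) n" if "x \<in> G" "x n" for x n
    using \<tau>_missed[OF _ that] \<theta> by (auto simp: phi_def dvd_eq_mod_eq_0)
  have R: "rotation ?B' \<in> Omega ?B' \<rightarrow>\<^sub>M Omega ?B'" by (rule measurable_rotation[OF B'(1)])
  have "ergodic (distr \<nu> (Omega ?B') \<theta>) (rotation ?B')"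
    by (rule ergodic_distr[OF erg \<theta>_meas R G(1,2)]) (use G(3) \<theta>_shift in auto)
  then have \<theta>_distr: "distr \<nu> (Omega ?B') \<theta> = Omega ?B'"
    by (intro rotation_uniquely_ergodic[OF B'(1) cop] prob_space_distr \<theta>_meas)
       (auto simp: ergodic_def invariant_measure_def)

  \<comment> \<open>On \<open>G\<close>, a one at position 0 forces all residues of
    \<open>\<theta> x\<close> to be nonzero. As \<open>\<theta>\<close> maps \<open>\<nu>\<close> to
    Haar measure, the positive mass of \<open>{x. x 0}\<close> bounds every such cylinder from
    below, uniformly in \<open>F\<close>.\<close>
  have "(\<lambda>b. 1 / real b) summable_on ?B'"
  proof (rule summable_if_missing_zero_positive[OF B'(1)])
    have one: "{x. x 0} \<in> sets \<nu>"
    proof -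
      have "Measurable.pred \<nu> (\<lambda>x. x (0::int))" by measurable
      then show ?thesis by (simp add: pred_def sp)
    qed
    show "0 < prob {x. x 0}"
      using False prob_eq_0[OF one] by (simp add: zero_less_measure_iff)
    fix F assume F: "finite F" "F \<subseteq> ?B'"
    have "prob {x. x 0} \<le> prob (\<theta> -` cylinder ?B' F (\<lambda>b. {1..<b}) \<inter> space \<nu>)"
    proof (rule finite_measure_mono_AE)
      show "\<theta> -` cylinder ?B' F (\<lambda>b. {1..<b}) \<inter> space \<nu> \<in> sets \<nu>"
        by (rule measurable_sets[OF \<theta>_meas cylinder_sets[OF F]])
      show "AE x in \<nu>. x \<in> {x. x 0} \<longrightarrow> x \<in> \<theta> -` cylinder ?B' F (\<lambda>b. {1..<b}) \<inter> space \<nu>"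
        using G(2)
      proof (eventually_elim, intro impI)
        fix x assume x: "x \<in> G" "x \<in> {x. x 0}"
        have "\<theta> x c \<in> {1..<c}" if c: "c \<in> F" for c
        proof -
          obtain b where b: "b \<in> B" "c = d b" using c F by blast
          have "\<not> int (d b) dvd int (\<tau> b x) + 0" using x by (intro \<tau>_missed[OF b(1)]) auto
          then have "\<tau> b x \<noteq> 0" by (intro notI) simp
          then show ?thesis using b \<theta>[OF b(1)] \<tau>_lt[OF b(1)] by simp
        qed
        then show "x \<in> \<theta> -` cylinder ?B' F (\<lambda>b. {1..<b}) \<inter> space \<nu>"
          using measurable_space[OF \<theta>_meas, of x] by (auto simp: cylinder_def sp)
      qed
    qed
    also have "\<dots> = measure (distr \<nu> (Omega ?B') \<theta>) (cylinder ?B' F (\<lambda>b. {1..<b}))"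
      by (rule measure_distr[OF \<theta>_meas cylinder_sets[OF F], symmetric])
    finally show "prob {x. x 0} \<le> measure (Omega ?B') (cylinder ?B' F (\<lambda>b. {1..<b}))"
      by (simp add: \<theta>_distr)
  qed
  then have adm': "admissible_B ?B'" using B'(2) cop by (simp add: admissible_B_def)

  define \<pi> where "\<pi> x = (phi ?B' (\<theta> x), x)" for x
  have phi\<theta>: "(\<lambda>x. phi ?B' (\<theta> x)) \<in> \<nu> \<rightarrow>\<^sub>M SS"
    by (rule measurable_compose[OF \<theta>_meas measurable_phi])
  have \<pi>: "\<pi> \<in> \<nu> \<rightarrow>\<^sub>M SS \<Otimes>\<^sub>M SS"
    unfolding \<pi>_def by (intro measurable_Pair phi\<theta>) measurable
  define \<rho> where "\<rho> = distr \<nu> (SS \<Otimes>\<^sub>M SS) \<pi>"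
  \<comment> \<open>Every value of \<open>phi ?B'\<close> lies in \<open>Xeta B\<close>, not merely
    almost every one, so the preimage is the whole space.\<close>
  have "emeasure \<rho> (Xeta B \<times> UNIV) = emeasure \<nu> (space \<nu>)"
    unfolding \<rho>_def using sets_Xeta[of B] sets.top[of SS] phi_in_Xeta[OF adm d(1) inf]
    by (subst emeasure_distr[OF \<pi>]) (auto simp: space_SS \<pi>_def intro!: arg_cong2[where f = emeasure])
  then have 1: "emeasure \<rho> (Xeta B \<times> UNIV) = 1" by (simp add: emeasure_space_1)
  have 2: "ergodic \<rho> (\<lambda>(x, u). (shift x, shift u))"
    unfolding \<rho>_def
    by (rule ergodic_distr[OF erg \<pi> measurable_shift_pair G(1,2)])
       (use G(3) in \<open>auto simp: \<pi>_def \<theta>_shift phi_rotation\<close>)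
  have "distr \<rho> SS fst = distr (distr \<nu> (Omega ?B') \<theta>) SS (phi ?B')"
    unfolding \<rho>_def distr_distr[OF measurable_phi \<theta>_meas]
    by (subst distr_distr[OF _ \<pi>]) (auto simp: comp_def \<pi>_def)
  then have 3: "distr \<rho> SS fst = mirsky ?B'" by (simp add: \<theta>_distr mirsky_def)
  have "distr \<rho> SS (\<lambda>(x, u). (\<lambda>n. x n \<and> u n)) = distr \<nu> SS (\<lambda>x n. phi ?B' (\<theta> x) n \<and> x n)"
    unfolding \<rho>_def by (subst distr_distr[OF measurable_conj_SS \<pi>]) (simp add: comp_def \<pi>_def)
  \<comment> \<open>On \<open>G\<close> the point \<open>x\<close> lies below
    \<open>phi ?B' (\<theta> x)\<close>, so multiplying by the latter returns
    \<open>x\<close>.\<close>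
  also have "\<dots> = distr \<nu> SS (\<lambda>x. x)"
  proof (rule distr_cong_AE)
    show "AE x in \<nu>. (\<lambda>n. phi ?B' (\<theta> x) n \<and> x n) = x"
      using G(2) by eventually_elim (use le in blast)
    show "(\<lambda>x n. phi ?B' (\<theta> x) n \<and> x n) \<in> \<nu> \<rightarrow>\<^sub>M SS"
      using measurable_comp[OF \<pi> measurable_conj_SS] by (simp add: comp_def \<pi>_def)
  qed auto
  also have "\<dots> = \<nu>" by (simp add: distr_id2 sets)
  finally have 4: "distr \<rho> SS (\<lambda>(x, u). (\<lambda>n. x n \<and> u n)) = \<nu>" .
  have 5: "prob_space \<rho>" unfolding \<rho>_def by (rule prob_space_distr[OF \<pi>])
  have 6: "sets \<rho> = sets (SS \<Otimes>\<^sub>M SS)" by (simp add: \<rho>_def)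
  show ?thesis
    using adm' Xeta_mono[OF adm d(1) inf] 5 6 1 2 3 4 by blast
qed

end
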